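(* Let $N\in[M]$, set $\omega_{\mathrm{av}}=\frac{M-N}{N(M-1)}$ and choose a real $b>1$. Set $a=\max\Big(1-(1+b)\frac{M-N}{N(M-1)},0\Big)$. In the algorithm Minibatch-SAGA (defined in the context) with sampling size $N$, suppose that the stepsize $\gamma$ satisfies $$0<\gamma\le\frac1L\,\frac1{a+(1+b)^2\omega_{\mathrm{av}}}.$$ Define the Lyapunov function, for every $k\ge 0$, $$\Psi^k=\|x^k-x^\star\|^2+(b^2+b)\gamma^2\omega_{\mathrm{av}}\frac1N\sum_{m=1}^M\|h_m^k-h_m^\star\|^2 .$$ Then, for every $k\ge0$, $\mathbb E[\Psi^k]\le c^k\Psi^0$, where $$c=1-\min\left\{\gamma\mu,\ \frac{N(1-b^{-2})}{M}\right\}<1.$$ Therefore, if $\gamma=\Theta(\frac1L)$, the asymptotic complexity of Minibatch-SAGA to achieve $\epsilon$-accuracy is $\mathcal O\big((\kappa+\frac MN)\log(1/\epsilon)\big)$ iterations and $\mathcal O\big((N\kappa+M)\log(1/\epsilon)\big)$ gradient calls, since there are $N$ gradient calls per iteration.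
   Context: Convention: $\frac{M-N}{N(M-1)}$ is read as $0$ when $M=N=1$. Problem. Let $d\ge1$, $M\ge1$, $[M]=\{1,\dots,M\}$. Let $F_1,\dots,F_M:\mathbb R^d\to\mathbb R$ be convex and $L$-smooth for some $L>0$ (i.e. differentiable with $\frac1L\nabla F_m$ nonexpansive), let $F=\frac1M\sum_{m=1}^M F_m$ be $\mu$-strongly convex for some $\mu>0$ (i.e. $F-\frac\mu2\|\cdot\|^2$ is convex), and let $R:\mathbb R^d\to\mathbb R\cup\{+\infty\}$ be proper, closed, convex. The problem is to minimize $R+F$ over $\mathbb R^d$; $x^\star$ is its unique solution, $h_m^\star=\nabla F_m(x^\star)$ for $m\in[M]$, and $\kappa=L/\mu$. For $\gamma>0$, $\mathrm{prox}_{\gamma R}(w)=\arg\min_{x\in\mathbb R^d}\big(\gamma R(x)+\frac12\|x-w\|^2\big)$. Norms are Euclidean and $\mathbb E$ denotes expectation. Algorithm Minibatch-SAGA. Input: stepsize $\gamma>0$, sampling size $N\in[M]$, initial vectors $x^0\in\mathbb R^d$ and $h_1^0,\dots,h_M^0\in\mathbb R^d$. Set $h^0=\frac1M\sum_{m=1}^M h_m^0$. For $k=0,1,\dots$: pick $\Omega^k\subset[M]$ of size $N$ uniformly at random (independently for different $k$); set $h_m^{k+1}=\nabla F_m(x^k)$ for $m\in\Omega^k$ and $h_m^{k+1}=h_m^k$ for $m\in[M]\setminus\Omega^k$; then set $d^{k+1}=\frac1N\sum_{m\in\Omega^k}(h_m^{k+1}-h_m^k)$, $x^{k+1}=\mathrm{prox}_{\gamma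 R}\big(x^k-\gamma(h^k+d^{k+1})\big)$, $h^{k+1}=h^k+\frac NM d^{k+1}$. *)

theory Defs
  imports "HOL-Probability.Probability"
begin

definition grad :: "(real ^ 'd \<Rightarrow> real) \<Rightarrow> real ^ 'd \<Rightarrow> real ^ 'd" where
  "grad f x = (THE g. GDERIV f x :> g)"

definition smooth_fun :: "real \<Rightarrow> (real ^ 'd \<Rightarrow> real) \<Rightarrow> bool" where
  "smooth_fun L f \<longleftrightarrow>
     (\<forall>x. f differentiable (at x)) \<and>
     1-lipschitz_on UNIV (\<lambda>x. (1 / L) *\<^sub>R grad f x)"

definition strongly_convex_fun :: "real \<Rightarrow> (real ^ 'd \<Rightarrow> real) \<Rightarrow> bool" where
  "strongly_convex_fun \<mu> f \<longleftrightarrow> convex_on UNIV (\<lambda>x. f x - \<mu> / 2 * (norm x)\<^sup>2)"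

text \<open>Convexity and closedness (lower semicontinuity) of an extended-real-valued function are
  those of its epigraph, the set of \<open>(x, r)\<close> with \<open>r\<close> real and \<open>R x \<le> r\<close>.\<close>

definition ereal_epigraph :: "(real ^ 'd \<Rightarrow> ereal) \<Rightarrow> ((real ^ 'd) \<times> real) set" where
  "ereal_epigraph R = {(x, r). R x \<le> ereal r}"

definition proper_closed_convex :: "(real ^ 'd \<Rightarrow> ereal) \<Rightarrow> bool" where
  "proper_closed_convex R \<longleftrightarrow>
     (\<forall>x. R x \<noteq> -\<infinity>) \<and> (\<exists>x. R x \<noteq> \<infinity>) \<and>
     closed (ereal_epigraph R) \<and> convex (ereal_epigraph R)"

definition prox :: "real \<Rightarrow> (real ^ 'd \<Rightarrow> ereal) \<Rightarrow> real ^ 'd \<Rightarrow> real ^ 'd" where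
  "prox \<gamma> R w =
     arg_min (\<lambda>x. ereal \<gamma> * R x + ereal (1 / 2 * (norm (x - w))\<^sup>2)) (\<lambda>_. True)"

definition avg_fun :: "nat \<Rightarrow> (nat \<Rightarrow> real ^ 'd \<Rightarrow> real) \<Rightarrow> real ^ 'd \<Rightarrow> real" where
  "avg_fun M F x = 1 / real M * (\<Sum>m=1..M. F m x)"

definition subsets_of_size :: "nat \<Rightarrow> nat \<Rightarrow> nat set set" where
  "subsets_of_size M N = {A. A \<subseteq> {1..M} \<and> card A = N}"

text \<open>The state after \<open>k\<close> iterations is the triple of \<open>x\<close>, the family of the \<open>h m\<close> and
  their running average, for a given realization \<open>\<Omega>\<close> of the sequence of sampled sets.\<close>

primrec minibatch_saga ::
  "nat \<Rightarrow> nat \<Rightarrow> (nat \<Rightarrow> real ^ 'd \<Rightarrow> real) \<Rightarrow> (real ^ 'd \<Rightarrow> ereal) \<Rightarrow> real \<Rightarrow>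
   real ^ 'd \<Rightarrow> (nat \<Rightarrow> real ^ 'd) \<Rightarrow> (nat \<Rightarrow> nat set) \<Rightarrow> nat \<Rightarrow>
   (real ^ 'd) \<times> (nat \<Rightarrow> real ^ 'd) \<times> (real ^ 'd)" where
  "minibatch_saga M N F R \<gamma> x0 h0 \<Omega> 0 = (x0, h0, (1 / real M) *\<^sub>R (\<Sum>m=1..M. h0 m))"
| "minibatch_saga M N F R \<gamma> x0 h0 \<Omega> (Suc k) =
     (let (x, h, hbar) = minibatch_saga M N F R \<gamma> x0 h0 \<Omega> k;
          h' = (\<lambda>m. if m \<in> \<Omega> k then grad (F m) x else h m);
          d = (1 / real N) *\<^sub>R (\<Sum>m\<in>\<Omega> k. h' m - h m)
      in (prox \<gamma> R (x - \<gamma> *\<^sub>R (hbar + d)), h', hbar + (real N / real M) *\<^sub>R d))"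

text \<open>Since division by zero yields zero, this is \<open>0\<close> for \<open>M = N = 1\<close>.\<close>

definition omega_av :: "nat \<Rightarrow> nat \<Rightarrow> real" where
  "omega_av M N = (real M - real N) / (real N * (real M - 1))"

definition lyapunov ::
  "nat \<Rightarrow> nat \<Rightarrow> (nat \<Rightarrow> real ^ 'd \<Rightarrow> real) \<Rightarrow> real \<Rightarrow> real \<Rightarrow> real ^ 'd \<Rightarrow>
   real ^ 'd \<Rightarrow> (nat \<Rightarrow> real ^ 'd) \<Rightarrow> real" where
  "lyapunov M N F b \<gamma> xstar x h =
     (norm (x - xstar))\<^sup>2 +
     (b\<^sup>2 + b) * \<gamma>\<^sup>2 * omega_av M N * (1 / real N) *
       (\<Sum>m=1..M. (norm (h m - grad (F m) xstar))\<^sup>2)"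

text \<open>Iteration \<open>k\<close> evaluates \<open>grad (F m)\<close> once for each \<open>m\<close> in \<open>\<Omega> k\<close>.\<close>

definition gradient_calls :: "(nat \<Rightarrow> nat set) \<Rightarrow> nat \<Rightarrow> nat" where
  "gradient_calls \<Omega> K = (\<Sum>k<K. card (\<Omega> k))"

text \<open>The constant hidden in the complexity bounds, for stepsizes with \<open>\<theta> / L \<le> \<gamma>\<close>. It is
  explicit because an existentially quantified one in a statement polymorphic in \<open>'d\<close> could
  depend on the dimension; this one depends on \<open>b\<close> and \<open>\<theta>\<close> only.\<close>

definition complexity_const :: "real \<Rightarrow> real \<Rightarrow> real" where
  "complexity_const b \<theta> = 3 * max (1 / \<theta>) (1 / (1 - 1 / b\<^sup>2))"

end

theory Submission
  imports Defs
begin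

text \<open>Optimality of \<open>xstar\<close> says that \<open>- \<nabla>F xstar\<close> is a subgradient of \<open>R\<close>, hence
  \<open>xstar = prox (xstar - \<gamma> \<nabla>F xstar)\<close>, and nonexpansiveness reduces the error of \<open>x\<close> to that of the
  gradient step. Averaged over the uniformly drawn batch, that step is a full gradient step plus
  \<open>\<gamma>\<^sup>2\<close> times the variance of sampling without replacement, which is \<open>omega_av\<close> times the variance
  of the \<open>\<nabla>F_m x - h_m\<close>. Young's inequality with parameter \<open>b\<close> splits the latter into a part due to
  \<open>\<nabla>F_m x - \<nabla>F_m xstar\<close> and a part due to \<open>h_m - \<nabla>F_m xstar\<close>. The second is absorbed by the decay of
  the control variates; by cocoercivity and the stepsize bound, the first, the squared gradient step
  and the refreshed control variates cost at most half of the descent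
  \<open>2 \<gamma> \<langle>x - xstar, \<nabla>F x - \<nabla>F xstar\<rangle>\<close>, and strong convexity turns the other half into the
  contraction \<open>1 - \<gamma> \<mu>\<close>.\<close>

section \<open>Smooth and strongly convex functions\<close>

text \<open>\<open>grad\<close> is a definite description, so uniqueness is needed besides
  existence. The derivative is a linear functional on a Euclidean space, hence represented by its
  values on \<open>Basis\<close>.\<close>

lemma GDERIV_grad:
  fixes f :: "real ^ 'd \<Rightarrow> real"
  assumes "f differentiable at x"
  shows "GDERIV f x :> grad f x"
proof -
  obtain f' where f': "(f has_derivative f') (at x)"
    using assms by (auto simp: differentiable_def)
  interpret bounded_linear f' using f' by (rule has_derivative_bounded_linear)
  define g where "g = (\<Sum>i\<in>Basis. f' i *\<^sub>R i)"
  have "f' = (\<lambda>h. h \<bullet> g)"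
  proof
    fix h
    have "f' h = f' (\<Sum>i\<in>Basis. (h \<bullet> i) *\<^sub>R i)" by (simp add: euclidean_representation)
    also have "\<dots> = h \<bullet> g" by (simp add: sum scale g_def inner_sum_right mult.commute)
    finally show "f' h = h \<bullet> g" .
  qed
  with f' have g: "GDERIV f x :> g" by (simp add: gderiv_def)
  moreover have "g' = g" if "GDERIV f x :> g'" for g'
  proof -
    have "(\<lambda>h. h \<bullet> g') = (\<lambda>h. h \<bullet> g)"
      using that g has_derivative_unique unfolding gderiv_def by blast
    then show ?thesis by (metis inner_eq_zero_iff inner_diff_right right_minus_eq)
  qed
  ultimately show ?thesis unfolding grad_def by (rule theI)
qed

lemma GDERIV_along_line:
  fixes f :: "'a::real_inner \<Rightarrow> real"
  assumes "GDERIV f (x + t *\<^sub>R v) :> g"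
  shows "((\<lambda>t. f (x + t *\<^sub>R v)) has_real_derivative (v \<bullet> g)) (at t within S)"
proof -
  have "((\<lambda>t. x + t *\<^sub>R v) has_derivative (\<lambda>s. s *\<^sub>R v)) (at t within S)"
    by (auto intro!: derivative_eq_intros)
  from has_derivative_compose[OF this assms[unfolded gderiv_def]]
  show ?thesis by (simp add: has_field_derivative_def mult_commute_abs)
qed

text \<open>Restriction to the line through \<open>x\<close> and \<open>z\<close> reduces this to
  the one-variable tangent inequality between the parameters \<open>0\<close> and
  \<open>1\<close>.\<close>

lemma convex_on_above_tangent_plane:
  fixes f :: "'a::real_inner \<Rightarrow> real"
  assumes "convex_on UNIV f" and "GDERIV f x :> g"
  shows "f x + (z - x) \<bullet> g \<le> f z"
proof -
  have "convex_on UNIV (\<lambda>t. f (x + t *\<^sub>R (z - x)))"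
  proof (rule convex_onI)
    fix t r s :: real assume "0 < t" "t < 1"
    have "x + ((1 - t) *\<^sub>R r + t *\<^sub>R s) *\<^sub>R (z - x)
        = (1 - t) *\<^sub>R (x + r *\<^sub>R (z - x)) + t *\<^sub>R (x + s *\<^sub>R (z - x))"
      by (simp add: algebra_simps)
    then show "f (x + ((1 - t) *\<^sub>R r + t *\<^sub>R s) *\<^sub>R (z - x))
        \<le> (1 - t) * f (x + r *\<^sub>R (z - x)) + t * f (x + s *\<^sub>R (z - x))"
      using convex_onD[OF assms(1), of t "x + r *\<^sub>R (z - x)" "x + s *\<^sub>R (z - x)"] \<open>0 < t\<close> \<open>t < 1\<close>
      by (simp del: scaleR_scaleR)
  qed simp
  from convex_on_imp_above_tangent[OF this, of 0 1 "(z - x) \<bullet> g"]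
  show ?thesis using GDERIV_along_line[of f x 0 "z - x" g] assms(2) by simp
qed

text \<open>Adding the tangent inequalities of the convex function in the first hypothesis at
  \<open>x\<close> and at \<open>y\<close> cancels all function values.\<close>

lemma strongly_convex_on_gradient_monotone:
  fixes f :: "'a::real_inner \<Rightarrow> real"
  assumes "convex_on UNIV (\<lambda>x. f x - \<mu> / 2 * (norm x)\<^sup>2)"
    and "GDERIV f x :> g" and "GDERIV f y :> h"
  shows "\<mu> * (norm (x - y))\<^sup>2 \<le> (x - y) \<bullet> (g - h)"
proof -
  have tangent: "GDERIV (\<lambda>x. f x - \<mu> / 2 * (norm x)\<^sup>2) z :> k - \<mu> *\<^sub>R z" if "GDERIV f z :> k" for z k
    using that unfolding gderiv_def power2_norm_eq_inner
    by (auto intro!: derivative_eq_intros simp: inner_diff_right inner_commute)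
  from convex_on_above_tangent_plane[OF assms(1) tangent[OF assms(2)], of y]
    convex_on_above_tangent_plane[OF assms(1) tangent[OF assms(3)], of x]
  show ?thesis
    by (simp add: power2_norm_eq_inner inner_diff_left inner_diff_right inner_commute algebra_simps)
qed

text \<open>The descent lemma. Instead of integrating the gradient, the claimed bound is subtracted
  along the segment; the remainder \<open>\<phi>\<close> has nonpositive derivative.\<close>

lemma smooth_quadratic_upper_bound:
  fixes f :: "'a::real_inner \<Rightarrow> real"
  assumes G: "\<And>x. GDERIV f x :> G x" and L: "\<And>x y. norm (G x - G y) \<le> L * norm (x - y)"
  shows "f y \<le> f x + (y - x) \<bullet> G x + L / 2 * (norm (y - x))\<^sup>2"
proof -
  define v where "v = y - x"
  define \<phi> where "\<phi> t = f (x + t *\<^sub>R v) - t * (v \<bullet> G x) - L / 2 * t\<^sup>2 * (norm v)\<^sup>2" for t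
  have "\<phi> 1 \<le> \<phi> 0"
  proof (rule DERIV_nonpos_imp_nonincreasing[where f = \<phi>])
    fix t :: real assume "0 \<le> t" "t \<le> 1"
    have "(\<phi> has_real_derivative v \<bullet> G (x + t *\<^sub>R v) - v \<bullet> G x - L * t * (norm v)\<^sup>2) (at t)"
      unfolding \<phi>_def by (auto intro!: derivative_eq_intros GDERIV_along_line G)
    moreover have "v \<bullet> G (x + t *\<^sub>R v) - v \<bullet> G x \<le> L * t * (norm v)\<^sup>2"
    proof -
      have "v \<bullet> (G (x + t *\<^sub>R v) - G x) \<le> norm v * norm (G (x + t *\<^sub>R v) - G x)"
        by (rule norm_cauchy_schwarz)
      also have "\<dots> \<le> norm v * (L * norm (t *\<^sub>R v))"
        using L[of "x + t *\<^sub>R v" x] by (intro mult_left_mono) auto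
      finally show ?thesis using \<open>0 \<le> t\<close> by (simp add: inner_diff_right power2_eq_square mult_ac)
    qed
    ultimately show "\<exists>d. (\<phi> has_real_derivative d) (at t) \<and> d \<le> 0" by force
  qed simp
  then show ?thesis by (simp add: \<phi>_def v_def)
qed

text \<open>The point \<open>z\<close> is a gradient step from \<open>y\<close> for \<open>f\<close>
  minus its linearization at \<open>x\<close>. There \<open>f\<close> lies above the tangent plane
  at \<open>x\<close> and below the quadratic bound at \<open>y\<close>.\<close>

lemma smooth_convex_lower_bound:
  fixes f :: "'a::real_inner \<Rightarrow> real"
  assumes "convex_on UNIV f" and "L > 0"
    and G: "\<And>x. GDERIV f x :> G x" and L: "\<And>x y. norm (G x - G y) \<le> L * norm (x - y)"
  shows "f x + (y - x) \<bullet> G x + (norm (G y - G x))\<^sup>2 / (2 * L) \<le> f y"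
proof -
  define v where "v = G y - G x"
  define z where "z = y - (1 / L) *\<^sub>R v"
  have "f x + (z - x) \<bullet> G x \<le> f z"
    by (rule convex_on_above_tangent_plane) (use assms in auto)
  also have "f z \<le> f y + (z - y) \<bullet> G y + L / 2 * (norm (z - y))\<^sup>2"
    by (rule smooth_quadratic_upper_bound) (use assms in auto)
  also have "(z - y) \<bullet> G y = (z - y) \<bullet> v + (z - y) \<bullet> G x"
    by (simp add: v_def inner_diff_right)
  also have "(z - y) \<bullet> v = - (norm v)\<^sup>2 / L"
    by (simp add: z_def power2_norm_eq_inner)
  also have "L / 2 * (norm (z - y))\<^sup>2 = (norm v)\<^sup>2 / (2 * L)"
    using \<open>L > 0\<close> by (simp add: z_def power_divide power2_eq_square)
  finally show ?thesis
    by (simp add: v_def inner_diff_left field_simps)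
qed

text \<open>The Baillon-Haddad inequality: the previous lower bound is added to itself with
  \<open>x\<close> and \<open>y\<close> exchanged.\<close>

lemma gradient_cocoercive:
  fixes f :: "'a::real_inner \<Rightarrow> real"
  assumes "convex_on UNIV f" and "L > 0"
    and G: "\<And>x. GDERIV f x :> G x" and L: "\<And>x y. norm (G x - G y) \<le> L * norm (x - y)"
  shows "(norm (G x - G y))\<^sup>2 \<le> L * ((x - y) \<bullet> (G x - G y))"
proof -
  have "(norm (G x - G y))\<^sup>2 / L = (norm (G y - G x))\<^sup>2 / (2 * L) + (norm (G x - G y))\<^sup>2 / (2 * L)"
    by (simp add: norm_minus_commute)
  also have "\<dots> \<le> (x - y) \<bullet> (G x - G y)"
    using smooth_convex_lower_bound[OF assms, of x y] smooth_convex_lower_bound[OF assms, of y x]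
    by (simp add: inner_diff_left inner_diff_right)
  finally show ?thesis using \<open>L > 0\<close> by (simp add: field_simps)
qed

text \<open>The conclusion says that \<open>- g\<close> is a subgradient of \<open>r\<close> at
  \<open>p\<close>; otherwise a short move towards \<open>z\<close> would decrease
  \<open>r + G\<close>. It serves both the solution \<open>xstar\<close> and proximal
  points.\<close>

lemma minimizer_variational_inequality:
  fixes r G :: "'a::real_inner \<Rightarrow> real"
  assumes "convex_on D r" and "p \<in> D" and "z \<in> D"
    and min: "\<And>y. y \<in> D \<Longrightarrow> r p + G p \<le> r y + G y"
    and "GDERIV G p :> g"
  shows "r p - (z - p) \<bullet> g \<le> r z"
proof (rule ccontr)
  assume "\<not> ?thesis"
  then have neg: "r z - r p + (z - p) \<bullet> g < 0" by simp
  \<comment> \<open>By convexity of \<open>r\<close>, the objective at parameter \<open>t\<close> of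
    the segment from \<open>p\<close> to \<open>z\<close> is at most \<open>r p + \<psi> t\<close>,
    with equality at \<open>t = 0\<close>.\<close>
  define \<psi> where "\<psi> t = t * (r z - r p) + G (p + t *\<^sub>R (z - p))" for t
  have "(\<psi> has_real_derivative r z - r p + (z - p) \<bullet> g) (at 0)"
    unfolding \<psi>_def by (rule derivative_eq_intros GDERIV_along_line refl | use assms(5) in simp)+
  from DERIV_neg_dec_right[OF this neg] obtain d
    where d: "d > 0" "\<And>h. 0 < h \<Longrightarrow> h < d \<Longrightarrow> \<psi> h < \<psi> 0" by auto
  \<comment> \<open>Below \<open>d\<close> for the strict decrease, and at most \<open>1\<close> so
    that \<open>y\<close> stays on the segment.\<close>
  define t where "t = min (d / 2) 1"
  have t: "0 < t" "t \<le> 1" "t < d" using d(1) by (auto simp: t_def)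
  define y where "y = (1 - t) *\<^sub>R p + t *\<^sub>R z"
  have "y \<in> D" unfolding y_def
    using assms(1-3) t by (intro convexD) (auto simp: convex_on_def)
  from min[OF this] have "r p + G p \<le> r y + G y" .
  also have "r y \<le> (1 - t) * r p + t * r z"
    unfolding y_def using assms(1-3) t by (intro convex_onD) auto
  also have "y = p + t *\<^sub>R (z - p)" by (simp add: y_def algebra_simps)
  finally have "\<psi> 0 \<le> \<psi> t" by (simp add: \<psi>_def algebra_simps)
  with d(2)[OF t(1,3)] show False by simp
qed

section \<open>The proximal operator\<close>

lemma real_of_proper_ereal_function:
  assumes "proper_closed_convex R" and "R z \<noteq> \<infinity>"
  shows "R z = ereal (real_of_ereal (R z))"
  using assms by (auto simp: proper_closed_convex_def ereal_real)

text \<open>The restriction to the effective domain matters because \<open>real_of_ereal\<close>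
  sends \<open>\<infinity>\<close> to \<open>0\<close>. Convex combinations of graph points stay in
  the epigraph, which yields convexity of the domain and of the function at once.\<close>

lemma convex_on_real_of_ereal:
  assumes R: "proper_closed_convex R"
  shows "convex_on {z. R z \<noteq> \<infinity>} (\<lambda>z. real_of_ereal (R z))"
proof -
  let ?r = "\<lambda>z. real_of_ereal (R z)"
  have E: "convex (ereal_epigraph R)" using R by (simp add: proper_closed_convex_def)
  have below: "R (u *\<^sub>R y + v *\<^sub>R z) \<le> ereal (u * ?r y + v * ?r z)"
    if "R y \<noteq> \<infinity>" "R z \<noteq> \<infinity>" "0 \<le> u" "0 \<le> v" "u + v = 1" for u v y z
  proof -
    have "u *\<^sub>R (y, ?r y) + v *\<^sub>R (z, ?r z) \<in> ereal_epigraph R"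
      using that real_of_proper_ereal_function[OF R]
      by (intro convexD[OF E]) (auto simp: ereal_epigraph_def)
    then show ?thesis by (simp add: ereal_epigraph_def)
  qed
  have "convex {z. R z \<noteq> \<infinity>}"
    using below by (force intro!: convexI)
  moreover have "?r ((1 - t) *\<^sub>R y + t *\<^sub>R z) \<le> (1 - t) * ?r y + t * ?r z"
    if "0 < t" "t < 1" "R y \<noteq> \<infinity>" "R z \<noteq> \<infinity>" for t y z
  proof -
    let ?y = "(1 - t) *\<^sub>R y + t *\<^sub>R z"
    have "R ?y \<le> ereal ((1 - t) * ?r y + t * ?r z)" using that by (intro below) auto
    moreover from this have "R ?y \<noteq> \<infinity>" by auto
    ultimately show ?thesis by (metis real_of_proper_ereal_function[OF R] ereal_less_eq(3))
  qed
  ultimately show ?thesis by (intro convex_onI) auto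
qed

text \<open>The affine minorant makes the objective coercive, so that a compact part of the epigraph
  suffices for the existence of the proximal point.\<close>

lemma prox_is_arg_min:
  assumes "\<gamma> > 0" and R: "proper_closed_convex R" and "R p \<noteq> \<infinity>"
    and minorant: "\<And>z. R z \<noteq> \<infinity> \<Longrightarrow> real_of_ereal (R p) + (z - p) \<bullet> g \<le> real_of_ereal (R z)"
  shows "is_arg_min (\<lambda>y. ereal \<gamma> * R y + ereal (1 / 2 * (norm (y - w))\<^sup>2)) (\<lambda>_. True) (prox \<gamma> R w)"
proof -
  let ?r = "\<lambda>z. real_of_ereal (R z)"
  let ?obj = "\<lambda>y. ereal \<gamma> * R y + ereal (1 / 2 * (norm (y - w))\<^sup>2)"
  \<comment> \<open>A real variable \<open>s\<close> replaces the value of \<open>R\<close>, which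
    makes the objective continuous on the closed epigraph although \<open>R\<close> may only be
    lower semicontinuous.\<close>
  define \<phi> where "\<phi> = (\<lambda>(z, s). \<gamma> * s + 1 / 2 * (norm (z - w))\<^sup>2)"
  \<comment> \<open>Completing the square after inserting the affine minorant puts every candidate
    no worse than \<open>p\<close> into the ball around \<open>w - \<gamma> *\<^sub>R g\<close>
    whose boundary passes through \<open>p\<close>.\<close>
  define \<rho> where "\<rho> = norm (p - (w - \<gamma> *\<^sub>R g))"
  define K where "K = ereal_epigraph R \<inter> {y. \<phi> y \<le> \<phi> (p, ?r p)}"
  have r: "R z = ereal (?r z)" if "R z \<noteq> \<infinity>" for z
    using R that by (rule real_of_proper_ereal_function)
  have cont: "continuous_on A \<phi>" for A
    unfolding \<phi>_def case_prod_unfold by (intro continuous_intros)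
  have "K \<subseteq> cball (w - \<gamma> *\<^sub>R g) \<rho> \<times> {?r p - 2 * \<rho> * norm g .. \<phi> (p, ?r p) / \<gamma>}"
  proof
    fix y assume "y \<in> K"
    then obtain z s where y: "y = (z, s)" and zs: "R z \<le> ereal s" "\<phi> (z, s) \<le> \<phi> (p, ?r p)"
      by (cases y) (auto simp: K_def ereal_epigraph_def)
    from zs(1) have "R z \<noteq> \<infinity>" by auto
    with zs(1) have "?r z \<le> s" by (metis r ereal_less_eq(3))
    with minorant[OF \<open>R z \<noteq> \<infinity>\<close>] have s: "?r p + (z - p) \<bullet> g \<le> s" by simp
    then have "\<gamma> * (?r p + (z - p) \<bullet> g) \<le> \<gamma> * s" using \<open>\<gamma> > 0\<close> by simp
    with zs(2) have "2 * (\<gamma> * ((z - p) \<bullet> g)) + (norm (z - w))\<^sup>2 \<le> (norm (p - w))\<^sup>2"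
      by (simp add: \<phi>_def distrib_left)
    then have "(norm (z - (w - \<gamma> *\<^sub>R g)))\<^sup>2 \<le> \<rho>\<^sup>2"
      unfolding \<rho>_def power2_norm_eq_inner
      by (simp add: inner_diff_left inner_diff_right inner_commute algebra_simps)
    then have z: "norm (z - (w - \<gamma> *\<^sub>R g)) \<le> \<rho>"
      by (rule power2_le_imp_le) (simp add: \<rho>_def)
    have "norm (z - p) \<le> norm (z - (w - \<gamma> *\<^sub>R g)) + norm (p - (w - \<gamma> *\<^sub>R g))"
      by (metis norm_triangle_ineq4 diff_diff_eq2 diff_add_cancel)
    with z have "norm (z - p) \<le> 2 * \<rho>" by (simp add: \<rho>_def)
    then have "norm (z - p) * norm g \<le> 2 * \<rho> * norm g" by (rule mult_right_mono) simp
    with s Cauchy_Schwarz_ineq2[of "z - p" g] have "?r p - 2 * \<rho> * norm g \<le> s" by linarith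
    moreover have "\<gamma> * s \<le> \<phi> (z, s)" by (simp add: \<phi>_def)
    with zs(2) have "\<gamma> * s \<le> \<phi> (p, ?r p)" by (rule order.trans[rotated])
    then have "s \<le> \<phi> (p, ?r p) / \<gamma>" using \<open>\<gamma> > 0\<close> by (simp add: field_simps)
    ultimately show "y \<in> cball (w - \<gamma> *\<^sub>R g) \<rho> \<times> {?r p - 2 * \<rho> * norm g .. \<phi> (p, ?r p) / \<gamma>}"
      using z by (simp add: y dist_norm norm_minus_commute)
  qed
  moreover have "closed K" unfolding K_def
    using R by (intro closed_Int closed_Collect_le cont continuous_on_const)
      (simp_all add: proper_closed_convex_def)
  ultimately have compact: "compact K"
    using compact_Int_closed[OF compact_Times[OF compact_cball compact_Icc]] by (metis inf.absorb_iff2)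
  have K_p: "(p, ?r p) \<in> K"
    using r[OF \<open>R p \<noteq> \<infinity>\<close>] by (simp add: K_def ereal_epigraph_def)
  then have "K \<noteq> {}" by auto
  from continuous_attains_inf[OF compact this cont]
  obtain y where "y \<in> K" and min: "\<And>y'. y' \<in> K \<Longrightarrow> \<phi> y \<le> \<phi> y'" by metis
  obtain z s where y: "y = (z, s)" by (cases y)
  have obj: "?obj u = ereal (\<phi> (u, ?r u))" if "R u \<noteq> \<infinity>" for u
    by (subst r[OF that]) (simp add: \<phi>_def)
  have "is_arg_min ?obj (\<lambda>_. True) z"
    unfolding is_arg_min_linorder
  proof (intro conjI allI impI)
    fix u
    have zs: "R z \<le> ereal s" using \<open>y \<in> K\<close> by (simp add: y K_def ereal_epigraph_def)
    then have "R z \<noteq> \<infinity>" by auto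
    with zs have "?r z \<le> s" by (metis r ereal_less_eq(3))
    then have "?obj z \<le> ereal (\<phi> y)"
      using \<open>\<gamma> > 0\<close> by (simp only: obj[OF \<open>R z \<noteq> \<infinity>\<close>]) (simp add: \<phi>_def y)
    also have "\<dots> \<le> ?obj u"
    proof (cases "R u = \<infinity>")
      case True
      then show ?thesis using \<open>\<gamma> > 0\<close> by simp
    next
      case False
      have "\<phi> y \<le> \<phi> (u, ?r u)"
      proof (cases "(u, ?r u) \<in> K")
        case True
        then show ?thesis by (rule min)
      next
        case notin: False
        have "(u, ?r u) \<in> ereal_epigraph R"
          using r[OF False] by (simp add: ereal_epigraph_def)
        \<comment> \<open>A point of the epigraph outside \<open>K\<close> has a larger value than
          \<open>(p, ?r p)\<close>, which belongs to \<open>K\<close>; so the minimum over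
          \<open>K\<close> is global.\<close>
        with notin min[OF K_p] show ?thesis by (simp add: K_def)
      qed
      then show ?thesis by (simp only: obj[OF False] ereal_less_eq)
    qed
    finally show "?obj z \<le> ?obj u" .
  qed simp
  \<comment> \<open>\<open>prox\<close> selects some minimizer, so the existence of one makes the
    selected point a minimizer.\<close>
  then show ?thesis unfolding prox_def arg_min_def by (rule someI)
qed

text \<open>The hypothesis on \<open>g\<close> says that it is a subgradient of \<open>R\<close> at \<open>p\<close>, so that \<open>p\<close> is the
  proximal point of \<open>p + \<gamma> g\<close>.\<close>

lemma norm_prox_diff_le:
  assumes "\<gamma> > 0" and R: "proper_closed_convex R" and "R p \<noteq> \<infinity>"
    and minorant: "\<And>z. R z \<noteq> \<infinity> \<Longrightarrow> real_of_ereal (R p) + (z - p) \<bullet> g \<le> real_of_ereal (R z)"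
  shows "norm (prox \<gamma> R w - p) \<le> norm (w - (p + \<gamma> *\<^sub>R g))"
proof -
  let ?r = "\<lambda>z. real_of_ereal (R z)"
  define q where "q = prox \<gamma> R w"
  \<comment> \<open>Dividing the proximal objective by \<open>\<gamma>\<close> isolates
    \<open>R\<close>, so that the variational inequality yields a subgradient of \<open>R\<close>
    itself at \<open>q\<close>.\<close>
  define G where "G y = 1 / (2 * \<gamma>) * (norm (y - w))\<^sup>2" for y
  have r: "R z = ereal (?r z)" if "R z \<noteq> \<infinity>" for z
    using R that by (rule real_of_proper_ereal_function)
  have min: "ereal \<gamma> * R q + ereal (1 / 2 * (norm (q - w))\<^sup>2)
      \<le> ereal \<gamma> * R y + ereal (1 / 2 * (norm (y - w))\<^sup>2)" for y
    using prox_is_arg_min[OF assms, of w] by (simp add: is_arg_min_linorder q_def)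
  have "ereal \<gamma> * R p + ereal (1 / 2 * (norm (p - w))\<^sup>2) < \<infinity>"
    by (subst r[OF \<open>R p \<noteq> \<infinity>\<close>]) simp
  with min[of p] have q: "R q \<noteq> \<infinity>" using \<open>\<gamma> > 0\<close> by auto
  have "?r q - (p - q) \<bullet> ((1 / \<gamma>) *\<^sub>R (q - w)) \<le> ?r p"
  proof (rule minimizer_variational_inequality[OF convex_on_real_of_ereal[OF R]])
    fix y assume "y \<in> {z. R z \<noteq> \<infinity>}"
    then have y: "R y \<noteq> \<infinity>" by simp
    have "\<gamma> * ?r q + 1 / 2 * (norm (q - w))\<^sup>2 \<le> \<gamma> * ?r y + 1 / 2 * (norm (y - w))\<^sup>2"
      using min[of y] by (subst (asm) r[OF q], subst (asm) r[OF y]) simp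
    then have "(\<gamma> * ?r q + 1 / 2 * (norm (q - w))\<^sup>2) / \<gamma> \<le> (\<gamma> * ?r y + 1 / 2 * (norm (y - w))\<^sup>2) / \<gamma>"
      using \<open>\<gamma> > 0\<close> by (intro divide_right_mono) auto
    then show "?r q + G q \<le> ?r y + G y"
      using \<open>\<gamma> > 0\<close> by (simp add: G_def add_divide_distrib)
  next
    show "GDERIV G q :> (1 / \<gamma>) *\<^sub>R (q - w)"
      unfolding gderiv_def G_def power2_norm_eq_inner
      using \<open>\<gamma> > 0\<close> by (auto intro!: derivative_eq_intros simp: inner_commute)
  qed (use q \<open>R p \<noteq> \<infinity>\<close> in auto)
  \<comment> \<open>Monotonicity of the subdifferential: the subgradient inequalities at
    \<open>p\<close> and at \<open>q\<close> are added and the values of \<open>R\<close>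
    cancel.\<close>
  with minorant[OF q] have "(q - p) \<bullet> g \<le> (p - q) \<bullet> (q - w) / \<gamma>" by simp
  then have "(q - p) \<bullet> (q - p) \<le> (q - p) \<bullet> (w - (p + \<gamma> *\<^sub>R g))"
    using \<open>\<gamma> > 0\<close>
    by (simp add: field_simps inner_diff_left inner_diff_right inner_add_right inner_commute)
  also have "\<dots> \<le> norm (q - p) * norm (w - (p + \<gamma> *\<^sub>R g))" by (rule norm_cauchy_schwarz)
  finally have "norm (q - p) * norm (q - p) \<le> norm (q - p) * norm (w - (p + \<gamma> *\<^sub>R g))"
    by (simp only: dot_square_norm power2_eq_square)
  then show ?thesis unfolding q_def[symmetric] by (cases "q = p") simp_all
qed

section \<open>Sampling without replacement\<close>

lemma finite_subsets_of_size: "finite (subsets_of_size M N)"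
  by (rule finite_subset[of _ "Pow {1..M}"]) (auto simp: subsets_of_size_def)

lemma card_subsets_of_size: "card (subsets_of_size M N) = M choose N"
  unfolding subsets_of_size_def using n_subsets[of "{1..M}" N] by simp

text \<open>Removing \<open>D\<close> is a bijection onto the subsets of the complement of size
  \<open>N - card D\<close>.\<close>

lemma card_subsets_of_size_superset:
  assumes "D \<subseteq> {1..M}" and "card D \<le> N"
  shows "card {A \<in> subsets_of_size M N. D \<subseteq> A} = (M - card D) choose (N - card D)"
proof -
  have "finite D" using assms(1) by (rule finite_subset) simp
  have "bij_betw (\<lambda>B. B \<union> D) {B. B \<subseteq> {1..M} - D \<and> card B = N - card D}
    {A \<in> subsets_of_size M N. D \<subseteq> A}"
  proof (rule bij_betw_byWitness[where f' = "\<lambda>A. A - D"])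
    show "(\<lambda>B. B \<union> D) ` {B. B \<subseteq> {1..M} - D \<and> card B = N - card D}
        \<subseteq> {A \<in> subsets_of_size M N. D \<subseteq> A}"
    proof clarify
      fix B assume B: "B \<subseteq> {1..M} - D" "card B = N - card D"
      then have "finite B" by (meson finite_Diff finite_atLeastAtMost finite_subset)
      with B \<open>finite D\<close> assms show "B \<union> D \<in> subsets_of_size M N \<and> D \<subseteq> B \<union> D"
        by (subst subsets_of_size_def) (auto simp: card_Un_disjoint disjoint_iff subset_iff)
    qed
    show "(\<lambda>A. A - D) ` {A \<in> subsets_of_size M N. D \<subseteq> A}
        \<subseteq> {B. B \<subseteq> {1..M} - D \<and> card B = N - card D}"
      using \<open>finite D\<close> by (auto simp: subsets_of_size_def card_Diff_subset)
  qed auto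
  then have "card {A \<in> subsets_of_size M N. D \<subseteq> A} = card {B. B \<subseteq> {1..M} - D \<and> card B = N - card D}"
    by (simp add: bij_betw_same_card)
  also have "\<dots> = card ({1..M} - D) choose (N - card D)" by (rule n_subsets) simp
  finally show ?thesis using assms \<open>finite D\<close> by (simp add: card_Diff_subset)
qed

text \<open>An index is drawn with probability \<open>N / M\<close>, by the absorption identity for
  binomial coefficients.\<close>

lemma card_subsets_of_size_member:
  assumes "m \<in> {1..M}" and "1 \<le> N" and "N \<le> M"
  shows "real (card {A \<in> subsets_of_size M N. m \<in> A}) = real (M choose N) * real N / real M"
proof -
  have "card {A \<in> subsets_of_size M N. m \<in> A} = (M - 1) choose (N - 1)"
    using card_subsets_of_size_superset[of "{m}" M N] assms by simp
  moreover have "N * (M choose N) = M * ((M - 1) choose (N - 1))"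
    using assms by (intro times_binomial_minus1_eq) auto
  then have "real N * real (M choose N) = real M * real ((M - 1) choose (N - 1))"
    by (metis of_nat_mult)
  ultimately show ?thesis using assms by (simp add: field_simps)
qed

lemma sum_subsets_of_size_sum:
  fixes u :: "nat \<Rightarrow> 'a::real_vector"
  assumes "1 \<le> N" and "N \<le> M"
  shows "(\<Sum>A\<in>subsets_of_size M N. \<Sum>m\<in>A. u m)
    = (real (M choose N) * real N / real M) *\<^sub>R (\<Sum>m=1..M. u m)"
proof -
  have "(\<Sum>A\<in>subsets_of_size M N. \<Sum>m\<in>A. u m)
      = (\<Sum>A\<in>subsets_of_size M N. \<Sum>m | m \<in> {1..M} \<and> m \<in> A. u m)"
    by (intro sum.cong) (auto simp: subsets_of_size_def)
  also have "\<dots> = (\<Sum>m=1..M. \<Sum>A | A \<in> subsets_of_size M N \<and> m \<in> A. u m)"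
    by (rule sum.swap_restrict) (simp_all add: finite_subsets_of_size)
  also have "\<dots> = (\<Sum>m=1..M. (real (M choose N) * real N / real M) *\<^sub>R u m)"
    using card_subsets_of_size_member[OF _ assms]
    by (intro sum.cong) (simp_all add: sum_constant_scaleR)
  finally show ?thesis by (simp add: scaleR_sum_right)
qed

text \<open>The second moment of the batch sum: an index occurs with probability
  \<open>N / M\<close>, a pair of distinct ones with probability
  \<open>N (N - 1) / (M (M - 1))\<close>. For the batch mean this is a combination, with weights
  \<open>omega_av M N\<close> and \<open>1 - omega_av M N\<close>, of the mean square and the
  squared norm of the mean.\<close>

lemma sum_subsets_of_size_norm_sum_power2:
  fixes u :: "nat \<Rightarrow> 'a::real_inner"
  assumes "1 \<le> N" and "N \<le> M"
  shows "(\<Sum>A\<in>subsets_of_size M N. (norm (\<Sum>m\<in>A. u m))\<^sup>2) = real (M choose N) * real N *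
    (omega_av M N * real N / real M * (\<Sum>m=1..M. (norm (u m))\<^sup>2)
     + (1 - omega_av M N) * real N / (real M)\<^sup>2 * (norm (\<Sum>m=1..M. u m))\<^sup>2)"
proof (cases "M = 1")
  \<comment> \<open>Here the denominator of \<open>omega_av\<close> vanishes; its value is
    \<open>0\<close> by convention and there is only one batch.\<close>
  case True
  with assms have [simp]: "M = Suc 0" "N = Suc 0" by simp_all
  have "subsets_of_size M N = {{1}}"
    by (auto simp: subsets_of_size_def card_1_singleton_iff)
  then show ?thesis by (simp add: omega_av_def)
next
  case False
  with assms have "2 \<le> M" by simp
  define q where "q = real (M choose N) * real N * (real N - 1) / (real M * (real M - 1))"
  have count: "real (card {A \<in> subsets_of_size M N. {m, l} \<subseteq> A}) = q"
    if "m \<in> {1..M}" "l \<in> {1..M}" "m \<noteq> l" for m l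
  proof (cases "N = 1")
    \<comment> \<open>Treated apart because of truncated subtraction:
      \<open>(M - 2) choose (N - 2)\<close> would be \<open>1\<close>, while no batch contains two
      indices.\<close>
    case True
    have "{A \<in> subsets_of_size M N. {m, l} \<subseteq> A} = {}"
      using that True by (auto simp: subsets_of_size_def card_1_singleton_iff)
    then show ?thesis using True by (simp only: q_def) simp
  next
    case False
    with assms have "2 \<le> N" by simp
    then have card: "card {A \<in> subsets_of_size M N. {m, l} \<subseteq> A} = (M - 2) choose (N - 2)"
      using card_subsets_of_size_superset[of "{m, l}" M N] that by (simp add: numeral_2_eq_2)
    have "real N * real (M choose N) = real M * real ((M - 1) choose (N - 1))"
      using times_binomial_minus1_eq[of N M] assms by (simp flip: of_nat_mult)
    moreover have "(N - 1) * ((M - 1) choose (N - 1)) = (M - 1) * ((M - 2) choose (N - 2))"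
      using times_binomial_minus1_eq[of "N - 1" "M - 1"] \<open>2 \<le> N\<close> by (simp add: numeral_2_eq_2)
    then have "real ((N - 1) * ((M - 1) choose (N - 1))) = real ((M - 1) * ((M - 2) choose (N - 2)))"
      by (simp only:)
    then have "(real N - 1) * real ((M - 1) choose (N - 1)) = (real M - 1) * real ((M - 2) choose (N - 2))"
      using assms by (simp add: of_nat_diff)
    ultimately have "real M * (real M - 1) * real ((M - 2) choose (N - 2))
        = real (M choose N) * real N * (real N - 1)"
      by algebra
    with card show ?thesis using \<open>2 \<le> M\<close> by (simp add: q_def eq_divide_eq mult.commute)
  qed
  have count_eq: "real (card {A \<in> subsets_of_size M N. m \<in> A}) = real (M choose N) * real N / real M"
    if "m \<in> {1..M}" for m
    using that assms by (rule card_subsets_of_size_member)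
  \<comment> \<open>The excess of the diagonal count over the off-diagonal one: all pairs get weight
    \<open>q\<close>, and equal indices get \<open>r\<close> in addition.\<close>
  define r where "r = real (M choose N) * real N / real M - q"
  have "(\<Sum>A\<in>subsets_of_size M N. (norm (\<Sum>m\<in>A. u m))\<^sup>2)
      = (\<Sum>A\<in>subsets_of_size M N. \<Sum>p\<in>A \<times> A. u (fst p) \<bullet> u (snd p))"
    by (simp add: power2_norm_eq_inner inner_sum_left inner_sum_right sum.cartesian_product
        case_prod_unfold inner_commute)
  also have "\<dots> = (\<Sum>A\<in>subsets_of_size M N.
      \<Sum>p | p \<in> {1..M} \<times> {1..M} \<and> {fst p, snd p} \<subseteq> A. u (fst p) \<bullet> u (snd p))"
    by (intro sum.cong) (auto simp: subsets_of_size_def)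
  also have "\<dots> = (\<Sum>p\<in>{1..M} \<times> {1..M}.
      \<Sum>A | A \<in> subsets_of_size M N \<and> {fst p, snd p} \<subseteq> A. u (fst p) \<bullet> u (snd p))"
    by (rule sum.swap_restrict) (simp_all add: finite_subsets_of_size)
  also have "\<dots> = (\<Sum>(m, l)\<in>{1..M} \<times> {1..M}. q * (u m \<bullet> u l) + (if m = l then r * (u m \<bullet> u l) else 0))"
  proof (intro sum.cong refl, clarify)
    fix m l assume ml: "m \<in> {1..M}" "l \<in> {1..M}"
    show "(\<Sum>A | A \<in> subsets_of_size M N \<and> {fst (m, l), snd (m, l)} \<subseteq> A. u (fst (m, l)) \<bullet> u (snd (m, l)))
        = q * (u m \<bullet> u l) + (if m = l then r * (u m \<bullet> u l) else 0)"
      using count[OF ml] count_eq[OF ml(1)] by (cases "m = l") (simp_all add: r_def algebra_simps)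
  qed
  also have "\<dots> = q * (norm (\<Sum>m=1..M. u m))\<^sup>2 + r * (\<Sum>m=1..M. (norm (u m))\<^sup>2)"
    by (simp add: power2_norm_eq_inner inner_sum_left inner_sum_right sum_distrib_left sum.distrib
        inner_commute flip: sum.cartesian_product)
  also have "q = real (M choose N) * real N * ((1 - omega_av M N) * real N / (real M)\<^sup>2)"
    using \<open>2 \<le> M\<close> assms by (simp add: q_def omega_av_def power2_eq_square divide_simps)
      (simp add: algebra_simps)
  also have "r = real (M choose N) * real N * (omega_av M N * real N / real M)"
    using \<open>2 \<le> M\<close> assms by (simp add: r_def q_def omega_av_def divide_simps)
      (simp add: algebra_simps)
  finally show ?thesis by (simp add: algebra_simps)
qed

lemma norm_diff_scaleR_power2:
  fixes u y :: "'a::real_inner"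
  shows "(norm (u - t *\<^sub>R y))\<^sup>2 = (norm u)\<^sup>2 - 2 * t * (u \<bullet> y) + t\<^sup>2 * (norm y)\<^sup>2"
  unfolding power2_norm_eq_inner
  by (simp add: inner_diff_left inner_diff_right inner_commute power2_eq_square)

text \<open>Bias-variance decomposition: the batch mean is unbiased, and its variance is
  \<open>omega_av M N\<close> times the variance of the whole family \<open>v\<close>.\<close>

lemma sum_subsets_of_size_norm_diff_mean_power2:
  fixes u :: "'a::real_inner" and v :: "nat \<Rightarrow> 'a"
  assumes "1 \<le> N" and "N \<le> M"
  defines "w \<equiv> (1 / real M) *\<^sub>R (\<Sum>m=1..M. v m)"
  shows "(\<Sum>A\<in>subsets_of_size M N. (norm (u - \<gamma> *\<^sub>R ((1 / real N) *\<^sub>R (\<Sum>m\<in>A. v m))))\<^sup>2)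
    = real (M choose N) * ((norm (u - \<gamma> *\<^sub>R w))\<^sup>2
        + \<gamma>\<^sup>2 * omega_av M N * ((\<Sum>m=1..M. (norm (v m))\<^sup>2) / real M - (norm w)\<^sup>2))"
proof -
  let ?S = "subsets_of_size M N"
  have "(\<Sum>A\<in>?S. (norm (u - \<gamma> *\<^sub>R ((1 / real N) *\<^sub>R (\<Sum>m\<in>A. v m))))\<^sup>2)
      = (\<Sum>A\<in>?S. (norm u)\<^sup>2 - 2 * (\<gamma> / real N) * (u \<bullet> (\<Sum>m\<in>A. v m))
          + (\<gamma> / real N)\<^sup>2 * (norm (\<Sum>m\<in>A. v m))\<^sup>2)"
    by (simp only: scaleR_scaleR norm_diff_scaleR_power2) simp
  also have "\<dots> = real (M choose N) * (norm u)\<^sup>2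
      - 2 * (\<gamma> / real N) * (u \<bullet> (\<Sum>A\<in>?S. \<Sum>m\<in>A. v m))
      + (\<gamma> / real N)\<^sup>2 * (\<Sum>A\<in>?S. (norm (\<Sum>m\<in>A. v m))\<^sup>2)"
    by (simp add: sum.distrib sum_subtractf card_subsets_of_size inner_sum_right sum_distrib_left)
  also have "\<dots> = real (M choose N) * ((norm u)\<^sup>2 - 2 * \<gamma> * (u \<bullet> w)
      + \<gamma>\<^sup>2 * (omega_av M N * ((\<Sum>m=1..M. (norm (v m))\<^sup>2) / real M)
          + (1 - omega_av M N) * (norm w)\<^sup>2))"
    unfolding sum_subsets_of_size_sum[OF assms(1,2)] sum_subsets_of_size_norm_sum_power2[OF assms(1,2)] w_def
    using assms by (simp add: power2_eq_square divide_simps) (simp add: algebra_simps)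
  finally show ?thesis by (simp add: norm_diff_scaleR_power2 algebra_simps)
qed

lemma sum_norm_diff_mean_power2:
  fixes v :: "'b \<Rightarrow> 'a::real_inner"
  defines "w I \<equiv> (1 / real (card I)) *\<^sub>R (\<Sum>i\<in>I. v i)"
  assumes "finite I" and "I \<noteq> {}"
  shows "(\<Sum>i\<in>I. (norm (v i - w I))\<^sup>2) = (\<Sum>i\<in>I. (norm (v i))\<^sup>2) - real (card I) * (norm (w I))\<^sup>2"
proof -
  have sum: "(\<Sum>i\<in>I. v i) = real (card I) *\<^sub>R w I" using assms by (simp add: w_def)
  have "(\<Sum>i\<in>I. (norm (v i - w I))\<^sup>2) = (\<Sum>i\<in>I. (norm (v i))\<^sup>2 - 2 * (v i \<bullet> w I) + (norm (w I))\<^sup>2)"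
    by (simp add: power2_norm_eq_inner inner_diff_left inner_diff_right inner_commute)
      (simp add: algebra_simps)
  also have "\<dots> = (\<Sum>i\<in>I. (norm (v i))\<^sup>2) - 2 * ((\<Sum>i\<in>I. v i) \<bullet> w I) + real (card I) * (norm (w I))\<^sup>2"
    by (simp add: sum.distrib sum_subtractf inner_sum_left sum_distrib_left)
  finally show ?thesis by (simp add: sum power2_norm_eq_inner)
qed

text \<open>Young's inequality, from expanding the nonnegative square of the norm of
  \<open>b *\<^sub>R p + q\<close>.\<close>

lemma norm_diff_power2_le:
  fixes p q :: "'a::real_inner"
  assumes "b > 0"
  shows "(norm (p - q))\<^sup>2 \<le> (1 + b) * (norm p)\<^sup>2 + (1 + 1 / b) * (norm q)\<^sup>2"
proof -
  have "0 \<le> (norm (b *\<^sub>R p + q))\<^sup>2 / b" using assms by simp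
  also have "\<dots> = b * (norm p)\<^sup>2 + 2 * (p \<bullet> q) + (norm q)\<^sup>2 / b"
    using assms unfolding power2_norm_eq_inner
    by (simp add: inner_add_left inner_add_right inner_commute field_simps)
  finally show ?thesis
    unfolding power2_norm_eq_inner
    by (simp add: inner_diff_left inner_diff_right inner_commute algebra_simps)
qed

text \<open>Only the variance of \<open>g\<close> enters, not its second moment: the subtracted squared norm of its
  mean is where the constant \<open>a\<close> of the stepsize bound comes from.\<close>

lemma variance_diff_le:
  fixes g e :: "'b \<Rightarrow> 'a::real_inner"
  assumes "finite I" and "I \<noteq> {}" and "b > 0"
  defines "n \<equiv> real (card I)"
  shows "(\<Sum>i\<in>I. (norm (g i - e i))\<^sup>2) / n - (norm ((1 / n) *\<^sub>R (\<Sum>i\<in>I. g i - e i)))\<^sup>2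
    \<le> (1 + b) * ((\<Sum>i\<in>I. (norm (g i))\<^sup>2) / n - (norm ((1 / n) *\<^sub>R (\<Sum>i\<in>I. g i)))\<^sup>2)
      + (1 + 1 / b) * ((\<Sum>i\<in>I. (norm (e i))\<^sup>2) / n)"
proof -
  let ?mean = "\<lambda>v. (1 / n) *\<^sub>R (\<Sum>i\<in>I. v i)"
  have "n > 0" using assms by (simp add: n_def card_gt_0_iff)
  have var: "(\<Sum>i\<in>I. (norm (v i - ?mean v))\<^sup>2) = (\<Sum>i\<in>I. (norm (v i))\<^sup>2) - n * (norm (?mean v))\<^sup>2"
    for v :: "'b \<Rightarrow> 'a"
    using sum_norm_diff_mean_power2[OF assms(1,2), of v] by (simp add: n_def)
  have "(\<Sum>i\<in>I. (norm (g i - e i - ?mean (\<lambda>i. g i - e i)))\<^sup>2)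
      = (\<Sum>i\<in>I. (norm ((g i - ?mean g) - (e i - ?mean e)))\<^sup>2)"
    by (simp add: sum_subtractf scaleR_diff_right algebra_simps)
  also have "\<dots> \<le> (\<Sum>i\<in>I. (1 + b) * (norm (g i - ?mean g))\<^sup>2 + (1 + 1 / b) * (norm (e i - ?mean e))\<^sup>2)"
    using assms by (intro sum_mono norm_diff_power2_le)
  also have "\<dots> = (1 + b) * (\<Sum>i\<in>I. (norm (g i - ?mean g))\<^sup>2)
      + (1 + 1 / b) * (\<Sum>i\<in>I. (norm (e i - ?mean e))\<^sup>2)"
    by (simp add: sum.distrib sum_distrib_left)
  \<comment> \<open>A variance is at most the second moment. The mean of \<open>e\<close> is given
    up here because the Lyapunov function records only second moments.\<close>
  also have "(1 + 1 / b) * (\<Sum>i\<in>I. (norm (e i - ?mean e))\<^sup>2) \<le> (1 + 1 / b) * (\<Sum>i\<in>I. (norm (e i))\<^sup>2)"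
    unfolding var using assms \<open>n > 0\<close> by (intro mult_left_mono) auto
  finally have "((\<Sum>i\<in>I. (norm (g i - e i))\<^sup>2) - n * (norm (?mean (\<lambda>i. g i - e i)))\<^sup>2) / n
      \<le> ((1 + b) * ((\<Sum>i\<in>I. (norm (g i))\<^sup>2) - n * (norm (?mean g))\<^sup>2)
        + (1 + 1 / b) * (\<Sum>i\<in>I. (norm (e i))\<^sup>2)) / n"
    unfolding var using \<open>n > 0\<close> by (intro divide_right_mono) auto
  then show ?thesis using \<open>n > 0\<close> by (simp add: diff_divide_distrib add_divide_distrib right_diff_distrib)
qed

text \<open>Gives the expected control-variate error: each entry is refreshed with probability
  \<open>N / M\<close>. The sum is that of \<open>v\<close> plus a correction over the batch, to
  which the first-moment formula applies.\<close>

lemma sum_subsets_of_size_sum_if: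
  fixes u v :: "nat \<Rightarrow> real"
  assumes "1 \<le> N" and "N \<le> M"
  shows "(\<Sum>A\<in>subsets_of_size M N. \<Sum>m=1..M. if m \<in> A then u m else v m)
    = real (M choose N) * ((1 - real N / real M) * (\<Sum>m=1..M. v m) + real N / real M * (\<Sum>m=1..M. u m))"
proof -
  have "(\<Sum>m=1..M. if m \<in> A then u m else v m) = (\<Sum>m=1..M. v m) + (\<Sum>m\<in>A. u m - v m)"
    if "A \<in> subsets_of_size M N" for A
  proof -
    have "(\<Sum>m=1..M. if m \<in> A then u m else v m) = (\<Sum>m=1..M. v m + (if m \<in> A then u m - v m else 0))"
      by (intro sum.cong) auto
    also have "\<dots> = (\<Sum>m=1..M. v m) + (\<Sum>m\<in>{1..M} \<inter> A. u m - v m)"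
      by (simp add: sum.distrib sum.inter_restrict)
    finally show ?thesis using that by (simp add: subsets_of_size_def Int_absorb1)
  qed
  then have "(\<Sum>A\<in>subsets_of_size M N. \<Sum>m=1..M. if m \<in> A then u m else v m)
      = (\<Sum>A\<in>subsets_of_size M N. (\<Sum>m=1..M. v m) + (\<Sum>m\<in>A. u m - v m))"
    by simp
  then show ?thesis
    by (simp only: sum.distrib sum_subsets_of_size_sum[OF assms])
      (simp add: card_subsets_of_size sum_subtractf algebra_simps)
qed

lemma omega_av_nonneg:
  assumes "1 \<le> N" and "N \<le> M"
  shows "0 \<le> omega_av M N"
  using assms by (auto simp: omega_av_def)

section \<open>Contraction of the Lyapunov function\<close>

lemma GDERIV_avg_fun:
  fixes F :: "nat \<Rightarrow> real ^ 'd \<Rightarrow> real"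
  assumes "\<And>m. m \<in> {1..M} \<Longrightarrow> GDERIV (F m) x :> g m"
  shows "GDERIV (avg_fun M F) x :> (1 / real M) *\<^sub>R (\<Sum>m=1..M. g m)"
proof -
  have "((\<lambda>x. 1 / real M * (\<Sum>m=1..M. F m x)) has_derivative
      (\<lambda>h. 1 / real M * (\<Sum>m=1..M. h \<bullet> g m))) (at x)"
    using assms by (intro has_derivative_mult_right has_derivative_sum) (simp add: gderiv_def)
  then show ?thesis
    by (simp add: gderiv_def avg_fun_def[abs_def] inner_sum_right)
qed

text \<open>One iteration from a fixed state. The sum over all batches is \<open>M choose N\<close>
  times the conditional expectation, so this part of the analysis is a finite computation free of
  probability theory.\<close>

lemma minibatch_saga_step:
  fixes F :: "nat \<Rightarrow> real ^ 'd \<Rightarrow> real"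
  assumes "1 \<le> N" and "N \<le> M" and "L > 0"
    and convex: "\<And>m. m \<in> {1..M} \<Longrightarrow> convex_on UNIV (F m)"
    and smooth: "\<And>m. m \<in> {1..M} \<Longrightarrow> smooth_fun L (F m)"
    and strong: "strongly_convex_fun \<mu> (avg_fun M F)"
    and R: "proper_closed_convex R"
    and xstar: "is_arg_min (\<lambda>y. R y + ereal (avg_fun M F y)) (\<lambda>_. True) xstar"
    and "b > 1"
    and a: "a = max (1 - (1 + b) * omega_av M N) 0"
    and "0 < \<gamma>" and \<gamma>: "\<gamma> \<le> 1 / L * (1 / (a + (1 + b)\<^sup>2 * omega_av M N))"
    and c: "c = 1 - min (\<gamma> * \<mu>) (real N * (1 - 1 / b\<^sup>2) / real M)"
    and hbar: "hbar = (1 / real M) *\<^sub>R (\<Sum>m=1..M. h m)"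
  shows "(\<Sum>A\<in>subsets_of_size M N. lyapunov M N F b \<gamma> xstar
      (prox \<gamma> R (x - \<gamma> *\<^sub>R (hbar + (1 / real N) *\<^sub>R (\<Sum>m\<in>A. grad (F m) x - h m))))
      (\<lambda>m. if m \<in> A then grad (F m) x else h m))
    \<le> real (M choose N) * (c * lyapunov M N F b \<gamma> xstar x h)"
proof -
  let ?\<omega> = "omega_av M N" and ?n = "real M" and ?C = "real (M choose N)"
  define r where "r z = real_of_ereal (R z)" for z
  define gstar where "gstar = (1 / ?n) *\<^sub>R (\<Sum>m=1..M. grad (F m) xstar)"
  define g where "g m = grad (F m) x - grad (F m) xstar" for m
  define e where "e m = h m - grad (F m) xstar" for m
  define gbar where "gbar = (1 / ?n) *\<^sub>R (\<Sum>m=1..M. g m)"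
  define q where "q = (\<Sum>m=1..M. (norm (g m))\<^sup>2) / ?n"
  define E where "E = (\<Sum>m=1..M. (norm (e m))\<^sup>2)"
  define X where "X = (norm (x - xstar))\<^sup>2"
  define I where "I = (x - xstar) \<bullet> gbar"
  define \<beta> where "\<beta> = (b\<^sup>2 + b) * \<gamma>\<^sup>2 * ?\<omega> * (1 / real N)"
  have pos: "real N > 0" "?n > 0" "?C > 0" using assms(1,2) by simp_all
  have \<omega>: "0 \<le> ?\<omega>" using assms(1,2) by (rule omega_av_nonneg)
  have deriv: "GDERIV (F m) y :> grad (F m) y" if "m \<in> {1..M}" for m y
    using smooth[OF that] by (intro GDERIV_grad) (simp add: smooth_fun_def)
  have lip: "norm (grad (F m) y - grad (F m) z) \<le> L * norm (y - z)" if "m \<in> {1..M}" for m y z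
  proof -
    have "dist ((1 / L) *\<^sub>R grad (F m) y) ((1 / L) *\<^sub>R grad (F m) z) \<le> 1 * dist y z"
      using smooth[OF that] unfolding smooth_fun_def by (intro lipschitz_onD[of 1 UNIV]) auto
    then have "norm ((1 / L) *\<^sub>R (grad (F m) y - grad (F m) z)) \<le> norm (y - z)"
      by (simp add: dist_norm scaleR_diff_right)
    then show ?thesis
      using \<open>L > 0\<close> by (simp add: pos_divide_le_eq mult.commute)
  qed
  have gbar_eq: "gbar = (1 / ?n) *\<^sub>R (\<Sum>m=1..M. grad (F m) x) - gstar"
    by (simp add: gbar_def g_def gstar_def sum_subtractf scaleR_diff_right)

  have optimal: "R xstar + ereal (avg_fun M F xstar) \<le> R y + ereal (avg_fun M F y)" for y
    using xstar by (simp add: is_arg_min_linorder)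
  obtain y where y: "R y \<noteq> \<infinity>" using R by (auto simp: proper_closed_convex_def)
  have finite: "R xstar \<noteq> \<infinity>"
    using optimal[of y] y by auto
  have "r xstar - (z - xstar) \<bullet> gstar \<le> r z" if "R z \<noteq> \<infinity>" for z
    unfolding r_def
  proof (rule minimizer_variational_inequality[OF convex_on_real_of_ereal[OF R]])
    show "GDERIV (avg_fun M F) xstar :> gstar"
      unfolding gstar_def by (intro GDERIV_avg_fun deriv)
  next
    fix y assume "y \<in> {z. R z \<noteq> \<infinity>}"
    then have "R y \<noteq> \<infinity>" by simp
    then obtain s t where st: "R xstar = ereal s" "R y = ereal t"
      using finite real_of_proper_ereal_function[OF R] by metis
    from optimal[of y]
    show "real_of_ereal (R xstar) + avg_fun M F xstar \<le> real_of_ereal (R y) + avg_fun M F y"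
      unfolding st by simp
  qed (use that finite in auto)
  then have prox: "norm (prox \<gamma> R w - xstar) \<le> norm (w - (xstar + \<gamma> *\<^sub>R (- gstar)))" for w
    using finite \<open>0 < \<gamma>\<close> R unfolding r_def by (intro norm_prox_diff_le) auto

  have mono: "\<mu> * X \<le> I"
    unfolding X_def I_def gbar_eq gstar_def
    using strong by (intro strongly_convex_on_gradient_monotone[of "avg_fun M F"] GDERIV_avg_fun deriv)
      (auto simp: strongly_convex_fun_def)
  have cocoercive: "q \<le> L * I"
  proof -
    have "(\<Sum>m=1..M. (norm (g m))\<^sup>2) \<le> (\<Sum>m=1..M. L * ((x - xstar) \<bullet> g m))"
      unfolding g_def
    proof (rule sum_mono)
      fix m assume m: "m \<in> {1..M}"
      show "(norm (grad (F m) x - grad (F m) xstar))\<^sup>2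
          \<le> L * ((x - xstar) \<bullet> (grad (F m) x - grad (F m) xstar))"
        using convex[OF m] \<open>L > 0\<close> deriv[OF m] lip[OF m] by (rule gradient_cocoercive)
    qed
    also have "\<dots> = L * ((x - xstar) \<bullet> (\<Sum>m=1..M. g m))"
      by (simp add: inner_sum_right sum_distrib_left)
    finally show ?thesis using pos by (simp add: q_def I_def gbar_def divide_simps)
  qed
  have "0 \<le> q" unfolding q_def by (simp add: sum_nonneg)
  have gbar_le: "(norm gbar)\<^sup>2 \<le> q"
  proof -
    have "0 \<le> (\<Sum>m=1..M. (norm (g m - gbar))\<^sup>2)" by (simp add: sum_nonneg)
    also have "\<dots> = ?n * q - ?n * (norm gbar)\<^sup>2"
      using sum_norm_diff_mean_power2[of "{1..M}" g] pos by (simp add: q_def gbar_def)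
    finally show ?thesis using pos by simp
  qed

  have step_x: "(\<Sum>A\<in>subsets_of_size M N. (norm (prox \<gamma> R (x - \<gamma> *\<^sub>R (hbar
        + (1 / real N) *\<^sub>R (\<Sum>m\<in>A. grad (F m) x - h m))) - xstar))\<^sup>2)
      \<le> ?C * (X - 2 * \<gamma> * I + \<gamma>\<^sup>2 * ((1 - (1 + b) * ?\<omega>) * (norm gbar)\<^sup>2)
          + \<gamma>\<^sup>2 * ?\<omega> * ((1 + b) * q + (1 + 1 / b) * (E / ?n)))"
  proof -
    define v where "v m = g m - e m" for m
    \<comment> \<open>The part of the step that does not depend on the batch. Its
      \<open>hbar\<close> cancels against the mean of the \<open>h m\<close> inside
      \<open>?vbar\<close>, which leaves the full gradient step.\<close>
    define u where "u = x - xstar - \<gamma> *\<^sub>R (hbar - gstar)"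
    let ?vbar = "(1 / ?n) *\<^sub>R (\<Sum>m=1..M. v m)"
    have v: "grad (F m) x - h m = v m" for m by (simp add: v_def g_def e_def)
    have "u - \<gamma> *\<^sub>R ?vbar = x - xstar - \<gamma> *\<^sub>R gbar"
      unfolding u_def hbar gbar_eq v_def g_def e_def
      by (simp add: sum_subtractf scaleR_diff_right algebra_simps)
    then have mean: "(norm (u - \<gamma> *\<^sub>R ?vbar))\<^sup>2 = X - 2 * \<gamma> * I + \<gamma>\<^sup>2 * (norm gbar)\<^sup>2"
      by (simp only: norm_diff_scaleR_power2 X_def I_def)
    have "(\<Sum>A\<in>subsets_of_size M N. (norm (prox \<gamma> R (x - \<gamma> *\<^sub>R (hbar
          + (1 / real N) *\<^sub>R (\<Sum>m\<in>A. grad (F m) x - h m))) - xstar))\<^sup>2)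
        \<le> (\<Sum>A\<in>subsets_of_size M N. (norm (u - \<gamma> *\<^sub>R ((1 / real N) *\<^sub>R (\<Sum>m\<in>A. v m))))\<^sup>2)"
    proof (intro sum_mono power_mono norm_ge_zero)
      fix A
      show "norm (prox \<gamma> R (x - \<gamma> *\<^sub>R (hbar + (1 / real N) *\<^sub>R (\<Sum>m\<in>A. grad (F m) x - h m))) - xstar)
          \<le> norm (u - \<gamma> *\<^sub>R ((1 / real N) *\<^sub>R (\<Sum>m\<in>A. v m)))"
        unfolding v by (rule order.trans[OF prox]) (simp add: u_def algebra_simps)
    qed
    also have "\<dots> = ?C * ((norm (u - \<gamma> *\<^sub>R ?vbar))\<^sup>2
        + \<gamma>\<^sup>2 * ?\<omega> * ((\<Sum>m=1..M. (norm (v m))\<^sup>2) / ?n - (norm ?vbar)\<^sup>2))"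
      using assms(1,2) by (rule sum_subsets_of_size_norm_diff_mean_power2)
    also have "\<dots> \<le> ?C * ((norm (u - \<gamma> *\<^sub>R ?vbar))\<^sup>2
        + \<gamma>\<^sup>2 * ?\<omega> * ((1 + b) * (q - (norm gbar)\<^sup>2) + (1 + 1 / b) * (E / ?n)))"
      using variance_diff_le[of "{1..M}" b g e] \<omega> \<open>b > 1\<close> assms(1,2)
      by (intro mult_left_mono add_left_mono) (auto simp: v_def q_def gbar_def E_def)
    finally show ?thesis unfolding mean by (simp add: algebra_simps)
  qed
  have step_h: "(\<Sum>A\<in>subsets_of_size M N. \<Sum>m=1..M.
        (norm ((if m \<in> A then grad (F m) x else h m) - grad (F m) xstar))\<^sup>2)
      = ?C * ((1 - real N / ?n) * E + real N * q)"
  proof -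
    have "(norm ((if m \<in> A then grad (F m) x else h m) - grad (F m) xstar))\<^sup>2
        = (if m \<in> A then (norm (g m))\<^sup>2 else (norm (e m))\<^sup>2)" for m A
      by (simp add: g_def e_def)
    with sum_subsets_of_size_sum_if[OF assms(1,2), of "\<lambda>m. (norm (g m))\<^sup>2" "\<lambda>m. (norm (e m))\<^sup>2"]
    show ?thesis using pos by (simp add: E_def q_def)
  qed

  \<comment> \<open>If the coefficient on the left is negative, the term is dropped and
    \<open>a = 0\<close>; otherwise the coefficient is \<open>a\<close> and Jensen's inequality
    \<open>gbar_le\<close> applies.\<close>
  have a_le: "(1 - (1 + b) * ?\<omega>) * (norm gbar)\<^sup>2 \<le> a * q"
    using a gbar_le by (intro mult_mono) auto
  have "\<gamma> * (a + (1 + b)\<^sup>2 * ?\<omega>) \<le> 1 / L"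
  proof -
    \<comment> \<open>For \<open>omega_av M N = 0\<close> the first summand is \<open>a = 1\<close>;
      otherwise the second one is positive.\<close>
    have "0 < a + (1 + b)\<^sup>2 * ?\<omega>"
    proof (cases "?\<omega> = 0")
      case False
      then show ?thesis using \<omega> a \<open>b > 1\<close> by (intro add_nonneg_pos) auto
    qed (simp add: a)
    then have "\<gamma> * (a + (1 + b)\<^sup>2 * ?\<omega>)
        \<le> 1 / L * (1 / (a + (1 + b)\<^sup>2 * ?\<omega>)) * (a + (1 + b)\<^sup>2 * ?\<omega>)"
      by (intro mult_right_mono[OF \<gamma>]) simp
    with \<open>0 < a + (1 + b)\<^sup>2 * ?\<omega>\<close> show ?thesis by simp
  qed
  then have "\<gamma> * (\<gamma> * (a + (1 + b)\<^sup>2 * ?\<omega>)) * q \<le> \<gamma> * (1 / L) * q"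
    using \<open>0 < \<gamma>\<close> \<open>0 \<le> q\<close> by (intro mult_right_mono mult_left_mono) auto
  also have "\<dots> \<le> \<gamma> * I"
    using cocoercive \<open>L > 0\<close> \<open>0 < \<gamma>\<close> by (simp add: field_simps)
  finally have stepsize: "\<gamma>\<^sup>2 * (a + (1 + b)\<^sup>2 * ?\<omega>) * q \<le> \<gamma> * I"
    by (simp add: power2_eq_square mult_ac)

  have scale: "?C * u + \<beta> * (?C * v) \<le> ?C * (c * (X + \<beta> * E))" if "u + \<beta> * v \<le> c * X + c * (\<beta> * E)" for u v
    using mult_left_mono[OF that, of ?C] by (simp add: algebra_simps)
  have "X - 2 * \<gamma> * I + \<gamma>\<^sup>2 * ((1 - (1 + b) * ?\<omega>) * (norm gbar)\<^sup>2)
        + \<gamma>\<^sup>2 * ?\<omega> * ((1 + b) * q + (1 + 1 / b) * (E / ?n)) + \<beta> * ((1 - real N / ?n) * E + real N * q)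
      \<le> X - 2 * \<gamma> * I + \<gamma>\<^sup>2 * (a * q)
        + \<gamma>\<^sup>2 * ?\<omega> * ((1 + b) * q + (1 + 1 / b) * (E / ?n)) + \<beta> * ((1 - real N / ?n) * E + real N * q)"
    using mult_left_mono[OF a_le, of "\<gamma>\<^sup>2"] by simp
  \<comment> \<open>The weight \<open>\<beta>\<close> is made for this line. In the coefficient of
    \<open>q\<close>, \<open>(1 + b)\<close> and \<open>b^2 + b\<close> add up to
    \<open>(1 + b)^2\<close>; in that of \<open>E\<close>, the sampling noise equals
    \<open>\<beta> N / (b^2 M)\<close> and offsets part of the decay
    \<open>\<beta> N / M\<close>.\<close>
  also have "\<dots> = X - 2 * \<gamma> * I + \<gamma>\<^sup>2 * (a + (1 + b)\<^sup>2 * ?\<omega>) * q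
      + (1 - real N * (1 - 1 / b\<^sup>2) / ?n) * (\<beta> * E)"
    using pos \<open>b > 1\<close> by (simp add: \<beta>_def field_simps power2_eq_square)
  also have "\<dots> \<le> X - \<gamma> * I + (1 - real N * (1 - 1 / b\<^sup>2) / ?n) * (\<beta> * E)"
    using stepsize by linarith
  also have "\<dots> \<le> (1 - \<gamma> * \<mu>) * X + (1 - real N * (1 - 1 / b\<^sup>2) / ?n) * (\<beta> * E)"
    using mult_left_mono[OF mono, of \<gamma>] \<open>0 < \<gamma>\<close> by (simp add: algebra_simps)
  \<comment> \<open>Being \<open>1\<close> minus a minimum, \<open>c\<close> is the larger of the
    two contraction factors.\<close>
  also have "\<dots> \<le> c * X + c * (\<beta> * E)"
  proof -
    have "0 \<le> X" "0 \<le> E" "0 \<le> \<beta>"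
      using \<omega> \<open>b > 1\<close> by (simp_all add: X_def E_def \<beta>_def sum_nonneg)
    then show ?thesis by (intro add_mono mult_right_mono) (auto simp: c)
  qed
  finally have total: "?C * (X - 2 * \<gamma> * I + \<gamma>\<^sup>2 * ((1 - (1 + b) * ?\<omega>) * (norm gbar)\<^sup>2)
        + \<gamma>\<^sup>2 * ?\<omega> * ((1 + b) * q + (1 + 1 / b) * (E / ?n)))
      + \<beta> * (?C * ((1 - real N / ?n) * E + real N * q)) \<le> ?C * (c * (X + \<beta> * E))"
    by (rule scale)
  have "(\<Sum>A\<in>subsets_of_size M N. lyapunov M N F b \<gamma> xstar
        (prox \<gamma> R (x - \<gamma> *\<^sub>R (hbar + (1 / real N) *\<^sub>R (\<Sum>m\<in>A. grad (F m) x - h m))))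
        (\<lambda>m. if m \<in> A then grad (F m) x else h m))
      = (\<Sum>A\<in>subsets_of_size M N. (norm (prox \<gamma> R (x - \<gamma> *\<^sub>R (hbar
          + (1 / real N) *\<^sub>R (\<Sum>m\<in>A. grad (F m) x - h m))) - xstar))\<^sup>2)
        + \<beta> * (?C * ((1 - real N / ?n) * E + real N * q))"
    unfolding step_h[symmetric] lyapunov_def \<beta>_def by (simp only: sum.distrib sum_distrib_left)
  also note add_right_mono[OF step_x]
  also note total
  also have "X + \<beta> * E = lyapunov M N F b \<gamma> xstar x h"
    by (simp add: lyapunov_def X_def \<beta>_def E_def e_def)
  finally show ?thesis .
qed

text \<open>The state at time \<open>k\<close> does not look ahead, so draws from \<open>k\<close>
  onwards may be changed or forgotten.\<close>

lemma minibatch_saga_cong: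
  assumes "\<And>j. j < k \<Longrightarrow> A j = B j"
  shows "minibatch_saga M N F R \<gamma> x0 h0 A k = minibatch_saga M N F R \<gamma> x0 h0 B k"
  using assms by (induction k) (simp_all add: Let_def)

lemma sum_minibatch_diff:
  fixes f h :: "nat \<Rightarrow> 'a::ab_group_add"
  assumes "A \<subseteq> {1..M}"
  shows "(\<Sum>m\<in>A. (if m \<in> A then f m else h m) - h m) = (\<Sum>m=1..M. if m \<in> A then f m else h m) - (\<Sum>m=1..M. h m)"
proof -
  have "(\<Sum>m=1..M. if m \<in> A then f m else h m) - (\<Sum>m=1..M. h m)
      = (\<Sum>m=1..M. (if m \<in> A then f m else h m) - h m)"
    by (simp add: sum_subtractf)
  also have "\<dots> = (\<Sum>m\<in>A. (if m \<in> A then f m else h m) - h m)"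
    using assms by (intro sum.mono_neutral_right) auto
  finally show ?thesis ..
qed

text \<open>Only entries of the batch change, so \<open>N / M\<close> times \<open>d\<close> is
  exactly the change of the average.\<close>

lemma minibatch_saga_average:
  assumes "1 \<le> N" and "\<And>j. j < k \<Longrightarrow> A j \<in> subsets_of_size M N"
  shows "snd (snd (minibatch_saga M N F R \<gamma> x0 h0 A k))
    = (1 / real M) *\<^sub>R (\<Sum>m=1..M. fst (snd (minibatch_saga M N F R \<gamma> x0 h0 A k)) m)"
  using assms(2)
proof (induction k)
  case (Suc k)
  obtain x h hbar where state: "minibatch_saga M N F R \<gamma> x0 h0 A k = (x, h, hbar)"
    by (metis surj_pair)
  have "A k \<subseteq> {1..M}" using Suc.prems[of k] by (simp add: subsets_of_size_def)
  note diff = sum_minibatch_diff[OF this, of "\<lambda>m. grad (F m) x" h]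
  have "hbar = (1 / real M) *\<^sub>R (\<Sum>m=1..M. h m)" using Suc state by simp
  then show ?case
    using \<open>1 \<le> N\<close> by (simp only: minibatch_saga.simps state Let_def prod.case fst_conv snd_conv diff)
      (simp add: scaleR_diff_right)
qed simp

section \<open>Independent draws\<close>

text \<open>A finite product of countable discrete spaces is discrete, so every function of a finite
  history is measurable.\<close>

lemma sets_PiM_uniform_count_measure:
  assumes "finite I" and "countable S"
  shows "sets (PiM I (\<lambda>_. uniform_count_measure S)) = Pow (PiE I (\<lambda>_. S))"
proof -
  have "sets (PiM I (\<lambda>_. uniform_count_measure S)) = sets (PiM I (\<lambda>_. count_space S))"
    by (intro sets_PiM_cong) (simp_all add: sets_uniform_count_measure_count_space)
  then show ?thesis using assms by (simp add: count_space_PiM_finite)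
qed

lemma borel_measurable_PiM_uniform_count_measure:
  assumes "finite I" and "countable S"
  shows "g \<in> borel_measurable (PiM I (\<lambda>_. uniform_count_measure S))"
proof (rule measurableI)
  fix A show "g -` A \<inter> space (PiM I (\<lambda>_. uniform_count_measure S))
      \<in> sets (PiM I (\<lambda>_. uniform_count_measure S))"
    by (simp add: sets_PiM_uniform_count_measure[OF assms] space_PiM space_uniform_count_measure)
qed simp

context prob_space
begin

text \<open>There are finitely many histories, so the sum of all absolute values is a bound.\<close>

lemma integrable_finite_history:
  fixes g :: "(nat \<Rightarrow> 'b) \<Rightarrow> real"
  assumes rv: "\<And>k. \<Omega> k \<in> M \<rightarrow>\<^sub>M uniform_count_measure S" and "finite S"
  shows "integrable M (\<lambda>\<omega>. g (restrict (\<lambda>j. \<Omega> j \<omega>) {..<k}))"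
proof (rule integrable_const_bound)
  let ?H = "PiE {..<k} (\<lambda>_. S)"
  have "finite ?H" using \<open>finite S\<close> by (intro finite_PiE) auto
  show "AE \<omega> in M. norm (g (restrict (\<lambda>j. \<Omega> j \<omega>) {..<k})) \<le> (\<Sum>f\<in>?H. \<bar>g f\<bar>)"
  proof (rule AE_I2)
    fix \<omega> assume "\<omega> \<in> space M"
    then have "restrict (\<lambda>j. \<Omega> j \<omega>) {..<k} \<in> ?H"
      using measurable_space[OF rv] by (auto simp: restrict_PiE_iff space_uniform_count_measure)
    then show "norm (g (restrict (\<lambda>j. \<Omega> j \<omega>) {..<k})) \<le> (\<Sum>f\<in>?H. \<bar>g f\<bar>)"
      unfolding real_norm_def
      by (rule member_le_sum[where f = "\<lambda>f. \<bar>g f\<bar>", OF _ abs_ge_zero \<open>finite ?H\<close>])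
  qed
  have "(\<lambda>\<omega>. restrict (\<lambda>j. \<Omega> j \<omega>) {..<k}) \<in> M \<rightarrow>\<^sub>M PiM {..<k} (\<lambda>_. uniform_count_measure S)"
    using rv by (intro measurable_restrict)
  then show "(\<lambda>\<omega>. g (restrict (\<lambda>j. \<Omega> j \<omega>) {..<k})) \<in> borel_measurable M"
    by (rule measurable_compose[OF _ borel_measurable_PiM_uniform_count_measure])
      (use \<open>finite S\<close> in \<open>auto intro: countable_finite\<close>)
qed

text \<open>Plays the part of conditioning on the past: the expectation is split by the value
  \<open>A\<close> of the next draw, whose indicator is independent of the history and has mean
  \<open>1 / card S\<close>.\<close>

lemma expectation_history_and_next:
  fixes g :: "(nat \<Rightarrow> 'b) \<Rightarrow> 'b \<Rightarrow> real"
  assumes indep: "indep_vars (\<lambda>_. uniform_count_measure S) \<Omega> UNIV"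
    and distr: "distr M (uniform_count_measure S) (\<Omega> k) = uniform_count_measure S"
    and "finite S"
  shows "expectation (\<lambda>\<omega>. g (restrict (\<lambda>j. \<Omega> j \<omega>) {..<k}) (\<Omega> k \<omega>))
    = expectation (\<lambda>\<omega>. (\<Sum>A\<in>S. g (restrict (\<lambda>j. \<Omega> j \<omega>) {..<k}) A) / real (card S))"
proof -
  let ?H = "\<lambda>\<omega>. restrict (\<lambda>j. \<Omega> j \<omega>) {..<k}"
  let ?U = "uniform_count_measure S"
  have rv: "\<Omega> j \<in> M \<rightarrow>\<^sub>M ?U" for j using indep by (simp add: indep_vars_def)
  have int_g: "integrable M (\<lambda>\<omega>. g (?H \<omega>) A)" for A
    using rv \<open>finite S\<close> by (rule integrable_finite_history)
  have indicator: "indicator {A} \<in> borel_measurable ?U" for A :: 'b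
    by (subst measurable_cong_sets[OF sets_uniform_count_measure_count_space refl]) simp
  have ind_int: "integrable M (\<lambda>\<omega>. indicator {A} (\<Omega> k \<omega>) :: real)" for A
    by (rule integrable_const_bound[where B = 1])
      (use measurable_compose[OF rv indicator] in \<open>auto simp: indicator_def\<close>)
  have prob: "expectation (\<lambda>\<omega>. indicator {A} (\<Omega> k \<omega>) :: real) = 1 / real (card S)" if "A \<in> S" for A
  proof -
    have "expectation (\<lambda>\<omega>. indicator {A} (\<Omega> k \<omega>) :: real) = integral\<^sup>L (distr M ?U (\<Omega> k)) (indicator {A})"
      by (rule integral_distr[OF rv indicator, symmetric])
    also have "\<dots> = 1 / real (card S)"
      unfolding distr integral_uniform_count_measure[OF \<open>finite S\<close>]
      using that \<open>finite S\<close> by (simp add: indicator_def sum.If_cases Int_absorb1)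
    finally show ?thesis .
  qed
  have iv: "indep_var borel (\<lambda>\<omega>. g (?H \<omega>) A) borel (\<lambda>\<omega>. indicator {A} (\<Omega> k \<omega>) :: real)" for A
  proof -
    \<comment> \<open>Disjoint blocks of draws are independent; the next draw is the one-element
      block \<open>{k}\<close>, evaluated at \<open>k\<close> afterwards.\<close>
    have "indep_var (PiM {..<k} (\<lambda>_. ?U)) ?H (PiM {k} (\<lambda>_. ?U)) (\<lambda>\<omega>. restrict (\<lambda>j. \<Omega> j \<omega>) {k})"
      by (rule indep_var_restrict[OF indep]) auto
    from indep_var_compose[OF this, of "\<lambda>f. g f A" borel "\<lambda>f. indicator {A} (f k)" borel]
    show ?thesis using \<open>finite S\<close>
      by (simp add: comp_def borel_measurable_PiM_uniform_count_measure countable_finite)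
  qed
  have "expectation (\<lambda>\<omega>. g (?H \<omega>) (\<Omega> k \<omega>))
      = expectation (\<lambda>\<omega>. \<Sum>A\<in>S. g (?H \<omega>) A * indicator {A} (\<Omega> k \<omega>))"
  proof (rule Bochner_Integration.integral_cong[OF refl])
    fix \<omega> assume "\<omega> \<in> space M"
    then have "\<Omega> k \<omega> \<in> S" using measurable_space[OF rv] by (simp add: space_uniform_count_measure)
    then show "g (?H \<omega>) (\<Omega> k \<omega>) = (\<Sum>A\<in>S. g (?H \<omega>) A * indicator {A} (\<Omega> k \<omega>))"
      using \<open>finite S\<close> by (simp add: indicator_def if_distrib cong: if_cong)
  qed
  also have "\<dots> = (\<Sum>A\<in>S. expectation (\<lambda>\<omega>. g (?H \<omega>) A * indicator {A} (\<Omega> k \<omega>)))"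
    by (intro Bochner_Integration.integral_sum indep_var_integrable iv int_g ind_int)
  also have "\<dots> = (\<Sum>A\<in>S. expectation (\<lambda>\<omega>. g (?H \<omega>) A) * (1 / real (card S)))"
    by (intro sum.cong refl) (simp add: indep_var_lebesgue_integral[OF iv int_g ind_int] prob)
  also have "\<dots> = expectation (\<lambda>\<omega>. (\<Sum>A\<in>S. g (?H \<omega>) A) / real (card S))"
    by (simp add: Bochner_Integration.integral_sum int_g sum_divide_distrib)
  finally show ?thesis .
qed

end

section \<open>Iteration complexity\<close>

text \<open>The factor \<open>2\<close> in the bound on \<open>k\<close> makes
  \<open>(1 - \<rho>) ^ k\<close> at most the square of \<open>\<epsilon>\<close>; one of the two
  factors absorbs \<open>C\<close>.\<close>

lemma exp_decay_iterations:
  fixes \<rho> \<epsilon> C :: real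
  assumes "0 < \<rho>" and "\<rho> \<le> 1" and "0 < \<epsilon>" and "\<epsilon> * C \<le> 1" and "0 \<le> C"
    and k: "2 * ln (1 / \<epsilon>) / \<rho> \<le> real k"
  shows "(1 - \<rho>) ^ k * C \<le> \<epsilon>"
proof -
  have "(1 - \<rho>) ^ k \<le> exp (- \<rho>) ^ k"
    using exp_ge_add_one_self[of "- \<rho>"] \<open>\<rho> \<le> 1\<close> by (intro power_mono) auto
  also have "\<dots> = exp (- (\<rho> * real k))" by (simp add: mult.commute flip: exp_of_nat_mult)
  also have "\<dots> \<le> exp (ln \<epsilon>) * exp (ln \<epsilon>)"
    unfolding exp_add[symmetric] using k \<open>0 < \<rho>\<close> \<open>0 < \<epsilon>\<close> by (simp add: ln_div field_simps)
  also have "\<dots> = \<epsilon> * \<epsilon>" using \<open>0 < \<epsilon>\<close> by simp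
  finally have "(1 - \<rho>) ^ k * C \<le> \<epsilon> * \<epsilon> * C" using \<open>0 \<le> C\<close> by (rule mult_right_mono)
  also have "\<dots> \<le> \<epsilon>" using mult_left_mono[OF \<open>\<epsilon> * C \<le> 1\<close>, of \<epsilon>] \<open>0 < \<epsilon>\<close> by (simp add: mult.assoc)
  finally show ?thesis .
qed

text \<open>Used with \<open>n = M / N\<close>. Each argument of the minimum is bounded separately:
  the first gives the condition number \<open>L / \<mu>\<close>, the second gives
  \<open>n\<close>.\<close>

lemma inverse_rate_le:
  fixes b \<theta> \<gamma> \<mu> L n :: real
  assumes "b > 1" and "\<theta> > 0" and "L > 0" and "\<mu> > 0" and "n > 0" and "\<theta> / L \<le> \<gamma>"
  shows "1 / min (\<gamma> * \<mu>) ((1 - 1 / b\<^sup>2) / n) \<le> max (1 / \<theta>) (1 / (1 - 1 / b\<^sup>2)) * (L / \<mu> + n)"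
proof -
  let ?m = "max (1 / \<theta>) (1 / (1 - 1 / b\<^sup>2))"
  have b: "0 < 1 - 1 / b\<^sup>2" using \<open>b > 1\<close> by (simp add: field_simps one_less_power)
  have m: "0 < ?m" using \<open>\<theta> > 0\<close> by (simp add: less_max_iff_disj)
  have "0 < \<theta> / L * \<mu>" using assms by simp
  moreover have "\<theta> / L * \<mu> \<le> \<gamma> * \<mu>" using assms by (intro mult_right_mono) auto
  ultimately have "1 / (\<gamma> * \<mu>) \<le> 1 / (\<theta> / L * \<mu>)" by (intro frac_le) auto
  also have "\<dots> = 1 / \<theta> * (L / \<mu>)" by simp
  also have "\<dots> \<le> ?m * (L / \<mu>)" using assms by (intro mult_right_mono) auto
  also have "\<dots> \<le> ?m * (L / \<mu> + n)" using m assms by (intro mult_left_mono) auto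
  finally have 1: "1 / (\<gamma> * \<mu>) \<le> ?m * (L / \<mu> + n)" .
  have "1 / ((1 - 1 / b\<^sup>2) / n) = 1 / (1 - 1 / b\<^sup>2) * n" by simp
  also have "\<dots> \<le> ?m * n" using assms by (intro mult_right_mono) auto
  also have "\<dots> \<le> ?m * (L / \<mu> + n)" using m assms by (intro mult_left_mono) auto
  finally have 2: "1 / ((1 - 1 / b\<^sup>2) / n) \<le> ?m * (L / \<mu> + n)" .
  show ?thesis using 1 2 by (simp only: min_def split: if_split) blast
qed

text \<open>The asymptotic claim takes the form of explicit bounds for all small
  \<open>\<epsilon>\<close>: \<open>\<epsilon> \<le> exp (-1)\<close> gives
  \<open>ln (1 / \<epsilon>) \<ge> 1\<close>, which absorbs rounding to an integer, and
  \<open>\<epsilon> * \<Psi>0 \<le> 1\<close> keeps the initial value out of the constant.\<close>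

theorem theorem7:
  fixes M N :: nat
    and F :: "nat \<Rightarrow> real ^ 'd \<Rightarrow> real"
    and R :: "real ^ 'd \<Rightarrow> ereal"
    and L \<mu> \<gamma> b a c :: real
    and xstar x0 :: "real ^ 'd"
    and h0 :: "nat \<Rightarrow> real ^ 'd"
    and P :: "'w measure"
    and \<Omega> :: "nat \<Rightarrow> 'w \<Rightarrow> nat set"
    and x :: "nat \<Rightarrow> 'w \<Rightarrow> real ^ 'd"
    and h :: "nat \<Rightarrow> 'w \<Rightarrow> nat \<Rightarrow> real ^ 'd"
    and \<Psi> :: "nat \<Rightarrow> 'w \<Rightarrow> real"
    and \<Psi>0 :: real
  assumes "1 \<le> N" and "N \<le> M"
    and "L > 0" and "\<mu> > 0"
    and "\<And>m. m \<in> {1..M} \<Longrightarrow> convex_on UNIV (F m)"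
    and "\<And>m. m \<in> {1..M} \<Longrightarrow> smooth_fun L (F m)"
    and "strongly_convex_fun \<mu> (avg_fun M F)"
    and "proper_closed_convex R"
    and "is_arg_min (\<lambda>y. R y + ereal (avg_fun M F y)) (\<lambda>_. True) xstar"
    and "prob_space P"
    and "prob_space.indep_vars P (\<lambda>_. uniform_count_measure (subsets_of_size M N)) \<Omega> UNIV"
    and "\<And>k. distr P (uniform_count_measure (subsets_of_size M N)) (\<Omega> k)
               = uniform_count_measure (subsets_of_size M N)"
    and "b > 1"
    and "a = max (1 - (1 + b) * omega_av M N) 0"
    and "0 < \<gamma>" and "\<gamma> \<le> 1 / L * (1 / (a + (1 + b)\<^sup>2 * omega_av M N))"
    and "\<And>k \<omega>. x k \<omega> = fst (minibatch_saga M N F R \<gamma> x0 h0 (\<lambda>j. \<Omega> j \<omega>) k)"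
    and "\<And>k \<omega>. h k \<omega> = fst (snd (minibatch_saga M N F R \<gamma> x0 h0 (\<lambda>j. \<Omega> j \<omega>) k))"
    and "\<And>k \<omega>. \<Psi> k \<omega> = lyapunov M N F b \<gamma> xstar (x k \<omega>) (h k \<omega>)"
    and "\<Psi>0 = lyapunov M N F b \<gamma> xstar x0 h0"
    and "c = 1 - min (\<gamma> * \<mu>) (real N * (1 - 1 / b\<^sup>2) / real M)"
  shows "c < 1 \<and>
    (\<forall>k. integrable P (\<Psi> k) \<and> prob_space.expectation P (\<Psi> k) \<le> c ^ k * \<Psi>0) \<and>
    (\<forall>\<theta>\<^sub>1 \<theta>\<^sub>2. 0 < \<theta>\<^sub>1 \<and> \<theta>\<^sub>1 / L \<le> \<gamma> \<and> \<gamma> \<le> \<theta>\<^sub>2 / L \<longrightarrow>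
      (\<forall>\<epsilon>. 0 < \<epsilon> \<and> \<epsilon> \<le> exp (-1) \<and> \<epsilon> * \<Psi>0 \<le> 1 \<longrightarrow>
        (\<exists>K::nat.
          (\<forall>k\<ge>K. prob_space.expectation P (\<Psi> k) \<le> \<epsilon>) \<and>
          real K \<le> complexity_const b \<theta>\<^sub>1 * ((L / \<mu> + real M / real N) * ln (1 / \<epsilon>)) \<and>
          (\<forall>\<omega>\<in>space P. real (gradient_calls (\<lambda>j. \<Omega> j \<omega>) K)
             \<le> complexity_const b \<theta>\<^sub>1 * ((real N * (L / \<mu>) + real M) * ln (1 / \<epsilon>))))))"
proof -
  interpret prob_space P by fact
  let ?S = "subsets_of_size M N" and ?C = "real (M choose N)"
  let ?saga = "minibatch_saga M N F R \<gamma> x0 h0"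
  define V where "V k A = lyapunov M N F b \<gamma> xstar (fst (?saga A k)) (fst (snd (?saga A k)))" for k A
  define H where "H k \<omega> = restrict (\<lambda>j. \<Omega> j \<omega>) {..<k}" for k \<omega>
  have "?C > 0" using assms(2) by simp
  have finite: "finite ?S" by (rule finite_subsets_of_size)
  have rv: "\<Omega> k \<in> P \<rightarrow>\<^sub>M uniform_count_measure ?S" for k
    using assms(11) by (simp add: indep_vars_def)
  then have \<Omega>: "\<Omega> k \<omega> \<in> ?S" if "\<omega> \<in> space P" for k \<omega>
    using measurable_space[OF rv that] by (simp add: space_uniform_count_measure)
  have V_cong: "V k A = V k B" if "\<And>j. j < k \<Longrightarrow> A j = B j" for k A B
    by (simp add: V_def minibatch_saga_cong[of k A B, OF that])
  \<comment> \<open>Expresses the Lyapunov value through the finite history \<open>H k\<close>, the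
    form required by the lemmas on independent draws.\<close>
  have \<Psi>_V: "\<Psi> k \<omega> = V k (H k \<omega>)" for k \<omega>
    unfolding assms(17-19) V_def[symmetric] by (rule V_cong) (simp add: H_def)
  have integrable: "integrable P (\<Psi> k)" for k
    using integrable_finite_history[OF rv finite, where g = "V k" and k = k] by (simp add: \<Psi>_V[abs_def] H_def)

  have b: "0 < 1 - 1 / b\<^sup>2" "1 - 1 / b\<^sup>2 < 1"
    using \<open>b > 1\<close> by (simp_all add: field_simps one_less_power)
  define \<rho> where "\<rho> = min (\<gamma> * \<mu>) (real N * (1 - 1 / b\<^sup>2) / real M)"
  have c: "c = 1 - \<rho>" using assms(21) by (simp add: \<rho>_def)
  have "0 < \<rho>" using assms(1-4) \<open>0 < \<gamma>\<close> b by (simp add: \<rho>_def)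
  \<comment> \<open>Yields \<open>\<rho> \<le> 1\<close>, that is \<open>c \<ge> 0\<close>; the
    induction for \<open>bound\<close> multiplies an inequality by \<open>c\<close>.\<close>
  have "real N * (1 - 1 / b\<^sup>2) \<le> real M * 1" using assms(1,2) b by (intro mult_mono) auto
  then have "\<rho> \<le> 1" using assms(1,2) by (simp add: \<rho>_def min_le_iff_disj divide_le_eq)

  have step: "(\<Sum>A\<in>?S. V (Suc k) (f(k := A))) \<le> ?C * (c * V k f)"
    if f: "\<And>j. j < k \<Longrightarrow> f j \<in> ?S" for k f
  proof -
    obtain x h hbar where state: "?saga f k = (x, h, hbar)" by (metis surj_pair)
    have hbar: "hbar = (1 / real M) *\<^sub>R (\<Sum>m=1..M. h m)"
      using minibatch_saga_average[where A = f and k = k, OF assms(1) f, of F R \<gamma> x0 h0] state by simp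
    have "V (Suc k) (f(k := A)) = lyapunov M N F b \<gamma> xstar
        (prox \<gamma> R (x - \<gamma> *\<^sub>R (hbar + (1 / real N) *\<^sub>R (\<Sum>m\<in>A. grad (F m) x - h m))))
        (\<lambda>m. if m \<in> A then grad (F m) x else h m)" for A
    proof -
      have "?saga (f(k := A)) k = (x, h, hbar)"
        unfolding state[symmetric] by (rule minibatch_saga_cong) simp
      then show ?thesis by (simp add: V_def Let_def)
    qed
    moreover have "V k f = lyapunov M N F b \<gamma> xstar x h" by (simp add: V_def state)
    ultimately show ?thesis
      using minibatch_saga_step[OF assms(1-3,5-9,13-16,21) hbar, of x] by simp
  qed
  have decay: "expectation (\<Psi> (Suc k)) \<le> c * expectation (\<Psi> k)" for k
  proof -
    \<comment> \<open>\<open>H k\<close> is undefined from \<open>k\<close> on, but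
      \<open>V (Suc k)\<close> reads no draw after \<open>k\<close>, so filling in position
      \<open>k\<close> suffices.\<close>
    have "expectation (\<Psi> (Suc k)) = expectation (\<lambda>\<omega>. V (Suc k) ((H k \<omega>)(k := \<Omega> k \<omega>)))"
      by (intro Bochner_Integration.integral_cong refl)
        (auto simp: \<Psi>_V H_def less_Suc_eq intro!: V_cong)
    also have "\<dots> = expectation (\<lambda>\<omega>. (\<Sum>A\<in>?S. V (Suc k) ((H k \<omega>)(k := A))) / ?C)"
      using expectation_history_and_next[OF assms(11,12) finite, where g = "\<lambda>f A. V (Suc k) (f(k := A))"]
      unfolding H_def card_subsets_of_size .
    also have "\<dots> \<le> expectation (\<lambda>\<omega>. c * \<Psi> k \<omega>)"
    proof (rule integral_mono)
      show "integrable P (\<lambda>\<omega>. (\<Sum>A\<in>?S. V (Suc k) ((H k \<omega>)(k := A))) / ?C)"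
        unfolding H_def using rv finite by (rule integrable_finite_history)
      show "integrable P (\<lambda>\<omega>. c * \<Psi> k \<omega>)" using integrable by simp
      fix \<omega> assume "\<omega> \<in> space P"
      then have "(\<Sum>A\<in>?S. V (Suc k) ((H k \<omega>)(k := A))) \<le> ?C * (c * \<Psi> k \<omega>)"
        unfolding \<Psi>_V by (intro step) (simp add: H_def \<Omega>)
      then show "(\<Sum>A\<in>?S. V (Suc k) ((H k \<omega>)(k := A))) / ?C \<le> c * \<Psi> k \<omega>"
        using \<open>?C > 0\<close> by (simp add: pos_divide_le_eq mult.commute)
    qed
    finally show ?thesis by simp
  qed
  have bound: "expectation (\<Psi> k) \<le> c ^ k * \<Psi>0" for k
  proof (induction k)
    case 0
    then show ?case by (simp add: assms(17-20) prob_space)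
  next
    case (Suc k)
    have "c * expectation (\<Psi> k) \<le> c * (c ^ k * \<Psi>0)"
      using Suc \<open>\<rho> \<le> 1\<close> by (intro mult_left_mono) (auto simp: c)
    with decay[of k] show ?case by (simp add: mult.assoc)
  qed

  have complexity: "\<exists>K::nat. (\<forall>k\<ge>K. expectation (\<Psi> k) \<le> \<epsilon>) \<and>
      real K \<le> complexity_const b \<theta> * ((L / \<mu> + real M / real N) * ln (1 / \<epsilon>)) \<and>
      (\<forall>\<omega>\<in>space P. real (gradient_calls (\<lambda>j. \<Omega> j \<omega>) K)
        \<le> complexity_const b \<theta> * ((real N * (L / \<mu>) + real M) * ln (1 / \<epsilon>)))"
    if "0 < \<theta>" "\<theta> / L \<le> \<gamma>" and \<epsilon>: "0 < \<epsilon>" "\<epsilon> \<le> exp (-1)" "\<epsilon> * \<Psi>0 \<le> 1" for \<theta> \<epsilon>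
  proof -
    have rate: "1 / \<rho> \<le> max (1 / \<theta>) (1 / (1 - 1 / b\<^sup>2)) * (L / \<mu> + real M / real N)"
      using inverse_rate_le[of b \<theta> L \<mu> "real M / real N" \<gamma>] that assms(1-4) \<open>b > 1\<close>
      by (simp add: \<rho>_def mult.commute)
    define K where "K = nat \<lceil>2 * ln (1 / \<epsilon>) / \<rho>\<rceil>"
    have "ln \<epsilon> \<le> ln (exp (-1))" using \<epsilon> by (subst ln_le_cancel_iff) auto
    then have ln: "1 \<le> ln (1 / \<epsilon>)" using \<epsilon> by (simp add: ln_div)
    have "1 \<le> ln (1 / \<epsilon>) / \<rho>" using ln \<open>0 < \<rho>\<close> \<open>\<rho> \<le> 1\<close> by (simp add: le_divide_eq)
    moreover have "real K \<le> 2 * ln (1 / \<epsilon>) / \<rho> + 1"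
      using calculation unfolding K_def by linarith
    \<comment> \<open>The constant \<open>3\<close> is \<open>2\<close> from the choice of
      \<open>K\<close> plus \<open>1\<close> for rounding up, as
      \<open>ln (1 / \<epsilon>) / \<rho> \<ge> 1\<close>.\<close>
    ultimately have "real K \<le> 3 * ln (1 / \<epsilon>) * (1 / \<rho>)" by simp
    also have "\<dots> \<le> 3 * ln (1 / \<epsilon>) * (max (1 / \<theta>) (1 / (1 - 1 / b\<^sup>2)) * (L / \<mu> + real M / real N))"
      by (rule mult_left_mono[OF rate]) (use ln in linarith)
    finally have K: "real K \<le> complexity_const b \<theta> * ((L / \<mu> + real M / real N) * ln (1 / \<epsilon>))"
      by (simp add: complexity_const_def mult_ac)
    have calls: "gradient_calls (\<lambda>j. \<Omega> j \<omega>) K = N * K" if "\<omega> \<in> space P" for \<omega>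
      using \<Omega>[OF that] by (simp add: gradient_calls_def subsets_of_size_def)
    have "real N * real K \<le> complexity_const b \<theta> * ((real N * (L / \<mu>) + real M) * ln (1 / \<epsilon>))"
    proof -
      have "real N * (L / \<mu>) + real M = real N * (L / \<mu> + real M / real N)"
        using assms(1) by (simp add: distrib_left)
      with mult_left_mono[OF K, of "real N"] show ?thesis by (simp add: mult_ac)
    qed
    moreover have "expectation (\<Psi> k) \<le> \<epsilon>" if "k \<ge> K" for k
    proof -
      have "2 * ln (1 / \<epsilon>) / \<rho> \<le> real k"
        using that unfolding K_def by linarith
      moreover have "0 \<le> \<Psi>0"
        using omega_av_nonneg[OF assms(1,2)] \<open>b > 1\<close>
        by (simp add: assms(20) lyapunov_def sum_nonneg)
      ultimately have "c ^ k * \<Psi>0 \<le> \<epsilon>"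
        unfolding c using \<open>0 < \<rho>\<close> \<open>\<rho> \<le> 1\<close> \<epsilon> by (intro exp_decay_iterations) auto
      with bound[of k] show ?thesis by simp
    qed
    ultimately show ?thesis using K calls by (intro exI[of _ K]) auto
  qed
  have "c < 1" using c \<open>0 < \<rho>\<close> by simp
  with integrable bound complexity show ?thesis by auto
qed

end
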